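(* Let $(X,d,A)$ be a metric pair with $A\neq\emptyset$ such that $X\setminus A$ is locally compact and $\sigma$-compact. For $f\in\mathrm{Lip}(X,A)$ let $\hat f:\mathcal{M}_1(X,A)\to\mathbb{R}$ be given by $\hat f(\mu)=\mu(f)$. Then $f\mapsto\hat f$ embeds $\mathrm{Lip}(X,A)$ as a Riesz subspace of the order continuous dual of $\mathcal{M}_1(X,A)$, i.e. it is an injective linear map into the order continuous dual that preserves the lattice operations. This map also embeds $\mathrm{Lip}_c(X,A)$ as a Riesz subspace of the order continuous dual of $\mathcal{M}_1(X,A)$.
   Context: A metric pair $(X,d,A)$ is a metric space $(X,d)$ with a closed subset $A\subset X$; $d_A(x)=\inf_{a\in A}d(x,a)$. Measures take values in $[0,\infty]$. Let $\mathcal{B}^+(X)$ be the commutative monoid of Borel measures on $X$ and $\mathcal{B}^+(X,A)=\mathcal{B}^+(X)/\mathcal{B}^+(A)$ the quotient monoid: $\mu\sim\nu$ iff $\mu+\sigma=\nu+\tau$ for some Borel measures $\sigma,\tau$ concentrated on $A$; equivalently $\mu,\nu$ agree on Borel subsets of $X\setminus A$, so relative Borel measures correspond bijectively to Borel measures on $X\setminus A$. For $f$ vanishing on $A$, $\mu(f)=\int_X f\,d\mu=\int_{X\setminus A}f\,d\mu$ is well defined. $\mu\in\mathcal{B}^+(X,A)$ is tight if $\mu(E)=\sup\{\mu(K): K\subset E \text{ compact}\}$ for every Borel $E\subset X\setminus A$. $\mathcal{M}_1^+(X,A)$ is the set of tight $\mu\in\mathcal{B}^+(X,A)$ with $\mu(d_A)<\infty$.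 It is a cancellative commutative monoid with an $\mathbb{R}^+$-action, and $\mathcal{M}_1(X,A)$ is its Grothendieck group (formal differences $\mu-\nu$), a Riesz space (vector lattice) with positive cone $\mathcal{M}_1^+(X,A)$; put $(\mu-\nu)(f)=\mu(f)-\nu(f)$. $\mathrm{Lip}(X,A)$ is the Riesz space of Lipschitz functions $f:X\to\mathbb{R}$ with $f|_A=0$, ordered pointwise; $\mathrm{Lip}_c(X,A)$ is its subspace of functions with compact support in $X$. For a Riesz space $E$, a net $x_\alpha\xrightarrow{o}0$ if there is a decreasing net $(y_\alpha)$ with the same index set with infimum $0$ in $E$ and $|x_\alpha|\le y_\alpha$. The order continuous dual of $E$ is the Riesz space of order bounded linear functionals $T:E\to\mathbb{R}$ (those mapping order intervals to bounded sets) such that $x_\alpha\xrightarrow{o}0$ implies $T(x_\alpha)\xrightarrow{o}0$ in $\mathbb{R}$, ordered by the cone of positive functionals. *)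

theory Defs
  imports "HOL-Analysis.Analysis"
begin

section \<open>Riesz spaces and their order continuous duals\<close>

text \<open>The spaces below depend on the closed set \<open>A\<close>, which is a term, so they are given by explicit
  carriers and operations. Suprema are taken among the elements of the carrier.\<close>

record 'v ordered_vs =
  carr :: "'v set"
  vzero :: 'v
  vplus :: "'v \<Rightarrow> 'v \<Rightarrow> 'v"
  vscale :: "real \<Rightarrow> 'v \<Rightarrow> 'v"
  vleq :: "'v \<Rightarrow> 'v \<Rightarrow> bool"

definition is_sup :: "'v ordered_vs \<Rightarrow> 'v set \<Rightarrow> 'v \<Rightarrow> bool" where
  "is_sup V S z \<longleftrightarrow> z \<in> carr V \<and> (\<forall>x\<in>S. vleq V x z) \<and>
     (\<forall>u\<in>carr V. (\<forall>x\<in>S. vleq V x u) \<longrightarrow> vleq V z u)"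

definition is_inf :: "'v ordered_vs \<Rightarrow> 'v set \<Rightarrow> 'v \<Rightarrow> bool" where
  "is_inf V S z \<longleftrightarrow> z \<in> carr V \<and> (\<forall>x\<in>S. vleq V z x) \<and>
     (\<forall>u\<in>carr V. (\<forall>x\<in>S. vleq V u x) \<longrightarrow> vleq V u z)"

definition is_abs :: "'v ordered_vs \<Rightarrow> 'v \<Rightarrow> 'v \<Rightarrow> bool" where
  "is_abs V x a \<longleftrightarrow> is_sup V {x, vscale V (-1) x} a"

definition real_riesz :: "real ordered_vs" where
  "real_riesz = \<lparr>carr = UNIV, vzero = 0, vplus = (+), vscale = (*), vleq = (\<le>)\<rparr>"

definition directed_preorder :: "'i set \<Rightarrow> ('i \<Rightarrow> 'i \<Rightarrow> bool) \<Rightarrow> bool" where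
  "directed_preorder D r \<longleftrightarrow> D \<noteq> {} \<and> (\<forall>i\<in>D. r i i) \<and>
     (\<forall>i\<in>D. \<forall>j\<in>D. \<forall>k\<in>D. r i j \<longrightarrow> r j k \<longrightarrow> r i k) \<and>
     (\<forall>i\<in>D. \<forall>j\<in>D. \<exists>k\<in>D. r i k \<and> r j k)"

definition order_null :: "'v ordered_vs \<Rightarrow> 'i set \<Rightarrow> ('i \<Rightarrow> 'i \<Rightarrow> bool) \<Rightarrow> ('i \<Rightarrow> 'v) \<Rightarrow> bool" where
  "order_null V D r x \<longleftrightarrow> x ` D \<subseteq> carr V \<and>
     (\<exists>y. y ` D \<subseteq> carr V \<and>
          (\<forall>i\<in>D. \<forall>j\<in>D. r i j \<longrightarrow> vleq V (y j) (y i)) \<and>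
          is_inf V (y ` D) (vzero V) \<and>
          (\<forall>i\<in>D. \<exists>a. is_abs V (x i) a \<and> vleq V a (y i)))"

definition linear_functional :: "'v ordered_vs \<Rightarrow> ('v \<Rightarrow> real) \<Rightarrow> bool" where
  "linear_functional V T \<longleftrightarrow>
     (\<forall>x\<in>carr V. \<forall>y\<in>carr V. T (vplus V x y) = T x + T y) \<and>
     (\<forall>c. \<forall>x\<in>carr V. T (vscale V c x) = c * T x)"

definition order_bounded :: "'v ordered_vs \<Rightarrow> ('v \<Rightarrow> real) \<Rightarrow> bool" where
  "order_bounded V T \<longleftrightarrow>
     (\<forall>a\<in>carr V. \<forall>b\<in>carr V. bounded (T ` {x\<in>carr V. vleq V a x \<and> vleq V x b}))"

text \<open>A definition cannot quantify over index types. Nets indexed by directed subsets of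
  \<open>'v \<times> 'v\<close> (with arbitrary preorders) suffice; lemma \<open>order_continuous_any_index\<close> below gives
  the property for nets over every index type.\<close>

definition order_continuous :: "'v ordered_vs \<Rightarrow> ('v \<Rightarrow> real) \<Rightarrow> bool" where
  "order_continuous V T \<longleftrightarrow>
     (\<forall>(D :: ('v \<times> 'v) set) r x. directed_preorder D r \<longrightarrow> order_null V D r x \<longrightarrow>
        order_null real_riesz D r (\<lambda>i. T (x i)))"

lemma order_continuous_any_index:
  fixes V :: "'v ordered_vs" and D :: "'i set"
  assumes refl: "\<And>u. u \<in> carr V \<Longrightarrow> vleq V u u"
    and trans: "\<And>u v w. u \<in> carr V \<Longrightarrow> v \<in> carr V \<Longrightarrow> w \<in> carr V \<Longrightarrow>
                  vleq V u v \<Longrightarrow> vleq V v w \<Longrightarrow> vleq V u w"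
    and T: "order_continuous V T"
    and D: "directed_preorder D r" and x: "order_null V D r x"
  shows "order_null real_riesz D r (\<lambda>i. T (x i))"
proof -
  obtain y where xD: "x ` D \<subseteq> carr V" and yD: "y ` D \<subseteq> carr V"
    and dec: "\<And>i j. i \<in> D \<Longrightarrow> j \<in> D \<Longrightarrow> r i j \<Longrightarrow> vleq V (y j) (y i)"
    and inf: "is_inf V (y ` D) (vzero V)"
    and dom: "\<And>i. i \<in> D \<Longrightarrow> \<exists>a. is_abs V (x i) a \<and> vleq V a (y i)"
    using x unfolding order_null_def by blast
  define p where "p i = (y i, x i)" for i
  define E where "E = p ` D"
  define s where "s = (\<lambda>(u :: 'v \<times> 'v) (v :: 'v \<times> 'v). vleq V (fst v) (fst u))"
  have "directed_preorder E s"
    unfolding directed_preorder_def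
  proof (intro conjI ballI impI)
    show "E \<noteq> {}" using D by (auto simp: directed_preorder_def E_def)
    show "s i i" if "i \<in> E" for i
      using that yD refl by (auto simp: E_def s_def p_def)
    show "s i k" if "i \<in> E" "j \<in> E" "k \<in> E" "s i j" "s j k" for i j k
    proof -
      have "fst i \<in> carr V" "fst j \<in> carr V" "fst k \<in> carr V"
        using that yD by (auto simp: E_def p_def)
      then show ?thesis using that(4,5) trans unfolding s_def by blast
    qed
    show "\<exists>k\<in>E. s i k \<and> s j k" if ij: "i \<in> E" "j \<in> E" for i j
    proof -
      obtain a b where ab: "a \<in> D" "b \<in> D" "i = p a" "j = p b"
        using ij unfolding E_def by blast
      obtain c where "c \<in> D" "r a c" "r b c"
        using D ab unfolding directed_preorder_def by blast
      then show ?thesis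
        using ab dec by (intro bexI[of _ "p c"]) (auto simp: s_def p_def E_def)
    qed
  qed
  moreover have "order_null V E s snd"
    unfolding order_null_def
  proof (intro conjI exI[of _ fst] ballI impI)
    show "snd ` E \<subseteq> carr V" using xD by (auto simp: E_def p_def)
    show "fst ` E \<subseteq> carr V" using yD by (auto simp: E_def p_def)
    show "vleq V (fst j) (fst i)" if "s i j" for i j
      using that by (simp add: s_def)
    have "fst ` E = y ` D" by (simp add: E_def p_def image_image)
    then show "is_inf V (fst ` E) (vzero V)" using inf by simp
    show "\<exists>a. is_abs V (snd i) a \<and> vleq V a (fst i)" if "i \<in> E" for i
      using that dom by (auto simp: E_def p_def)
  qed
  ultimately have "order_null real_riesz E s (\<lambda>i. T (snd i))"
    using T unfolding order_continuous_def by blast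
  then obtain z where dec': "\<And>i j. i \<in> E \<Longrightarrow> j \<in> E \<Longrightarrow> s i j \<Longrightarrow> vleq real_riesz (z j) (z i)"
    and inf': "is_inf real_riesz (z ` E) (vzero real_riesz)"
    and dom': "\<And>i. i \<in> E \<Longrightarrow> \<exists>a. is_abs real_riesz (T (snd i)) a \<and> vleq real_riesz a (z i)"
    unfolding order_null_def by blast
  show ?thesis
    unfolding order_null_def
  proof (intro conjI exI[of _ "\<lambda>i. z (p i)"] ballI impI)
    show "(\<lambda>i. T (x i)) ` D \<subseteq> carr real_riesz" "(\<lambda>i. z (p i)) ` D \<subseteq> carr real_riesz"
      by (auto simp: real_riesz_def)
    show "vleq real_riesz (z (p j)) (z (p i))" if "i \<in> D" "j \<in> D" "r i j" for i j
      using dec'[of "p i" "p j"] dec[OF that] that by (simp add: E_def s_def p_def)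
    have "(\<lambda>i. z (p i)) ` D = z ` E" by (simp add: E_def image_image)
    then show "is_inf real_riesz ((\<lambda>i. z (p i)) ` D) (vzero real_riesz)" using inf' by simp
    show "\<exists>a. is_abs real_riesz (T (x i)) a \<and> vleq real_riesz a (z (p i))" if "i \<in> D" for i
      using dom'[of "p i"] that by (simp add: E_def p_def)
  qed
qed

text \<open>Functionals are \<open>extensional\<close>, so that equal functionals on \<open>carr V\<close> are equal
  as HOL functions.\<close>

definition order_continuous_dual :: "'v ordered_vs \<Rightarrow> ('v \<Rightarrow> real) ordered_vs" where
  "order_continuous_dual V =
    \<lparr>carr = {T \<in> extensional (carr V).
               linear_functional V T \<and> order_bounded V T \<and> order_continuous V T},
     vzero = (\<lambda>x\<in>carr V. 0),
     vplus = (\<lambda>S T. \<lambda>x\<in>carr V. S x + T x),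
     vscale = (\<lambda>c T. \<lambda>x\<in>carr V. c * T x),
     vleq = (\<lambda>S T. \<forall>x\<in>carr V. vleq V (vzero V) x \<longrightarrow> S x \<le> T x)\<rparr>"

text \<open>Injective linear maps preserving binary suprema and infima; the existence of these
  suprema and infima, in both spaces, is part of the definition.\<close>

definition riesz_embedding :: "'v ordered_vs \<Rightarrow> 'w ordered_vs \<Rightarrow> ('v \<Rightarrow> 'w) \<Rightarrow> bool" where
  "riesz_embedding V W \<phi> \<longleftrightarrow>
     \<phi> ` carr V \<subseteq> carr W \<and> inj_on \<phi> (carr V) \<and>
     (\<forall>x\<in>carr V. \<forall>y\<in>carr V. \<phi> (vplus V x y) = vplus W (\<phi> x) (\<phi> y)) \<and>
     (\<forall>c. \<forall>x\<in>carr V. \<phi> (vscale V c x) = vscale W c (\<phi> x)) \<and>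
     (\<forall>x\<in>carr V. \<forall>y\<in>carr V. \<exists>z. is_sup V {x, y} z \<and> is_sup W {\<phi> x, \<phi> y} (\<phi> z)) \<and>
     (\<forall>x\<in>carr V. \<forall>y\<in>carr V. \<exists>z. is_inf V {x, y} z \<and> is_inf W {\<phi> x, \<phi> y} (\<phi> z))"


section \<open>Relative Borel measures\<close>

definition borel_measures :: "'a::metric_space measure set" where
  "borel_measures = {\<mu>. sets \<mu> = sets borel}"

definition add_measure :: "'a measure \<Rightarrow> 'a measure \<Rightarrow> 'a measure" where
  "add_measure \<mu> \<nu> = measure_of (space \<mu>) (sets \<mu>) (\<lambda>E. emeasure \<mu> E + emeasure \<nu> E)"

definition borel_measures_on :: "'a::metric_space set \<Rightarrow> 'a measure set" where
  "borel_measures_on A = {\<sigma> \<in> borel_measures. emeasure \<sigma> (- A) = 0}"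

definition rel_equiv :: "'a::metric_space set \<Rightarrow> ('a measure \<times> 'a measure) set" where
  "rel_equiv A = {(\<mu>, \<nu>). \<mu> \<in> borel_measures \<and> \<nu> \<in> borel_measures \<and>
     (\<exists>\<sigma>\<in>borel_measures_on A. \<exists>\<tau>\<in>borel_measures_on A. add_measure \<mu> \<sigma> = add_measure \<nu> \<tau>)}"

type_synonym 'a rel_measure = "'a measure set"

definition rel_measures :: "'a::metric_space set \<Rightarrow> 'a rel_measure set" where
  "rel_measures A = borel_measures // rel_equiv A"

definition rel_zero :: "'a::metric_space set \<Rightarrow> 'a rel_measure" where
  "rel_zero A = rel_equiv A `` {null_measure borel}"

definition rel_add ::
    "'a::metric_space set \<Rightarrow> 'a rel_measure \<Rightarrow> 'a rel_measure \<Rightarrow> 'a rel_measure" where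
  "rel_add A M N = (\<Union>\<mu>\<in>M. \<Union>\<nu>\<in>N. rel_equiv A `` {add_measure \<mu> \<nu>})"

definition rel_scale :: "'a::metric_space set \<Rightarrow> real \<Rightarrow> 'a rel_measure \<Rightarrow> 'a rel_measure" where
  "rel_scale A c M = (\<Union>\<mu>\<in>M. rel_equiv A `` {scale_measure (ennreal c) \<mu>})"

text \<open>The values below do not depend on the representative when \<open>E \<subseteq> - A\<close> and when
  \<open>f\<close> is a Borel function vanishing on \<open>A\<close>; \<open>the_elem\<close> is used only in these cases.\<close>

definition rel_emeasure :: "'a::metric_space rel_measure \<Rightarrow> 'a set \<Rightarrow> ennreal" where
  "rel_emeasure M E = the_elem ((\<lambda>\<mu>. emeasure \<mu> E) ` M)"

definition rel_nn_integral :: "'a::metric_space rel_measure \<Rightarrow> ('a \<Rightarrow> ennreal) \<Rightarrow> ennreal" where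
  "rel_nn_integral M f = the_elem ((\<lambda>\<mu>. \<integral>\<^sup>+x. f x \<partial>\<mu>) ` M)"

definition rel_integral :: "'a::metric_space rel_measure \<Rightarrow> ('a \<Rightarrow> real) \<Rightarrow> real" where
  "rel_integral M f = the_elem ((\<lambda>\<mu>. \<integral>x. f x \<partial>\<mu>) ` M)"

definition rel_tight :: "'a::metric_space set \<Rightarrow> 'a rel_measure \<Rightarrow> bool" where
  "rel_tight A M \<longleftrightarrow> (\<forall>E\<in>sets borel. E \<subseteq> - A \<longrightarrow>
     rel_emeasure M E = (SUP K\<in>{K. compact K \<and> K \<subseteq> E}. rel_emeasure M K))"

definition M1_plus :: "'a::metric_space set \<Rightarrow> 'a rel_measure set" where
  "M1_plus A = {M \<in> rel_measures A. rel_tight A M \<and> rel_nn_integral M (\<lambda>x. ennreal (infdist x A)) < \<infinity>}"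


section \<open>The Riesz space of differences of relative measures\<close>

text \<open>Since \<open>M1_plus A\<close> is cancellative, its Grothendieck group is obtained from pairs \<open>(M, N)\<close>,
  standing for \<open>M - N\<close>, without an additional summand on both sides.\<close>

type_synonym 'a rel_diff = "('a rel_measure \<times> 'a rel_measure) set"

definition diff_equiv :: "'a::metric_space set \<Rightarrow>
    (('a rel_measure \<times> 'a rel_measure) \<times> ('a rel_measure \<times> 'a rel_measure)) set" where
  "diff_equiv A = {((M, N), (M', N')).
     M \<in> M1_plus A \<and> N \<in> M1_plus A \<and> M' \<in> M1_plus A \<and> N' \<in> M1_plus A \<and>
     rel_add A M N' = rel_add A M' N}"

definition diff_add :: "'a::metric_space set \<Rightarrow> 'a rel_diff \<Rightarrow> 'a rel_diff \<Rightarrow> 'a rel_diff" where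
  "diff_add A x y =
     (\<Union>(M, N)\<in>x. \<Union>(M', N')\<in>y. diff_equiv A `` {(rel_add A M M', rel_add A N N')})"

definition diff_scale :: "'a::metric_space set \<Rightarrow> real \<Rightarrow> 'a rel_diff \<Rightarrow> 'a rel_diff" where
  "diff_scale A c x = (\<Union>(M, N)\<in>x. diff_equiv A ``
     {if c \<ge> 0 then (rel_scale A c M, rel_scale A c N)
      else (rel_scale A (- c) N, rel_scale A (- c) M)})"

definition diff_of :: "'a::metric_space set \<Rightarrow> 'a rel_measure \<Rightarrow> 'a rel_diff" where
  "diff_of A M = diff_equiv A `` {(M, rel_zero A)}"

definition M1 :: "'a::metric_space set \<Rightarrow> 'a rel_diff ordered_vs" where
  "M1 A = \<lparr>carr = (M1_plus A \<times> M1_plus A) // diff_equiv A,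
           vzero = diff_of A (rel_zero A),
           vplus = diff_add A,
           vscale = diff_scale A,
           vleq = (\<lambda>x y. \<exists>M\<in>M1_plus A. y = diff_add A x (diff_of A M))\<rparr>"

definition diff_integral :: "'a::metric_space rel_diff \<Rightarrow> ('a \<Rightarrow> real) \<Rightarrow> real" where
  "diff_integral x f = the_elem ((\<lambda>(M, N). rel_integral M f - rel_integral N f) ` x)"


section \<open>Lipschitz functions vanishing on a subset\<close>

definition Lip :: "'a::metric_space set \<Rightarrow> ('a \<Rightarrow> real) ordered_vs" where
  "Lip A = \<lparr>carr = {f. (\<exists>L. L-lipschitz_on UNIV f) \<and> (\<forall>a\<in>A. f a = 0)},
            vzero = (\<lambda>x. 0),
            vplus = (\<lambda>f g x. f x + g x),
            vscale = (\<lambda>c f x. c * f x),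
            vleq = (\<le>)\<rparr>"

definition Lip_c :: "'a::metric_space set \<Rightarrow> ('a \<Rightarrow> real) ordered_vs" where
  "Lip_c A = (Lip A)\<lparr>carr := {f \<in> carr (Lip A). compact (closure {x. f x \<noteq> 0})}\<rparr>"

definition hat :: "'a::metric_space set \<Rightarrow> ('a \<Rightarrow> real) \<Rightarrow> 'a rel_diff \<Rightarrow> real" where
  "hat A f = (\<lambda>x\<in>carr (M1 A). diff_integral x f)"

end

theory Submission
  imports Defs "HOL-Probability.Giry_Monad"
begin

text \<open>A relative measure \<open>\<mu>\<close> in \<open>M1_plus A\<close> is encoded by the finite measure \<open>E \<mapsto> \<integral>\<^sub>E d_A d\<mu>\<close>, from which
  it is recovered on \<open>- A\<close> by integrating \<open>1 / d_A\<close>; a finite Borel measure below such a measure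
  arises in the same way, since tightness passes to smaller measures. A function \<open>f\<close> in \<open>Lip A\<close>
  satisfies \<open>\<bar>f\<bar> \<le> C d_A\<close>, so \<open>\<bar>\<mu>(f)\<bar> \<le> C \<nu>(d_A)\<close> whenever \<open>\<bar>\<mu>\<bar> \<le> \<nu>\<close>. Hence order continuity
  reduces to \<open>\<nu>\<^sub>i(d_A) \<rightarrow> 0\<close> for a net \<open>\<nu>\<^sub>i\<close> decreasing to \<open>0\<close>: the setwise infimum of the finite measures
  above is again a measure, hence a lower bound of the net, hence \<open>0\<close>. A linear functional \<open>T\<close> above
  the functionals of \<open>f\<close> and \<open>g\<close> is above that of \<open>max f g\<close>, as is seen by splitting a positive
  measure along \<open>{f \<ge> g}\<close>. Injectivity follows by evaluating at Dirac measures.\<close>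

section \<open>Sums and multiples of measures\<close>

lemma sets_add_measure [simp, measurable_cong]: "sets (add_measure \<mu> \<nu>) = sets \<mu>"
  by (simp add: add_measure_def)

lemma space_add_measure [simp]: "space (add_measure \<mu> \<nu>) = space \<mu>"
  by (simp add: add_measure_def)

lemma emeasure_add_measure:
  assumes sets_eq: "sets \<nu> = sets \<mu>"
  shows "emeasure (add_measure \<mu> \<nu>) E = emeasure \<mu> E + emeasure \<nu> E"
proof (cases "E \<in> sets \<mu>")
  case True
  show ?thesis
    unfolding add_measure_def
  proof (rule emeasure_measure_of_sigma)
    show "sigma_algebra (space \<mu>) (sets \<mu>)" ..
    show "positive (sets \<mu>) (\<lambda>E. emeasure \<mu> E + emeasure \<nu> E)"
      by (simp add: positive_def)
    show "countably_additive (sets \<mu>) (\<lambda>E. emeasure \<mu> E + emeasure \<nu> E)"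
    proof (rule countably_additiveI)
      fix B :: "nat \<Rightarrow> _"
      assume B: "range B \<subseteq> sets \<mu>" "disjoint_family B" "(\<Union>i. B i) \<in> sets \<mu>"
      have "(\<Sum>i. emeasure \<mu> (B i) + emeasure \<nu> (B i)) =
          (\<Sum>i. emeasure \<mu> (B i)) + (\<Sum>i. emeasure \<nu> (B i))"
        by (rule suminf_add[symmetric]) auto
      also have "\<dots> = emeasure \<mu> (\<Union>i. B i) + emeasure \<nu> (\<Union>i. B i)"
        using B sets_eq by (simp add: suminf_emeasure)
      finally show "(\<Sum>i. emeasure \<mu> (B i) + emeasure \<nu> (B i)) =
          emeasure \<mu> (\<Union>i. B i) + emeasure \<nu> (\<Union>i. B i)" .
    qed
  qed (fact True)
next
  case False
  then show ?thesis
    using sets_eq by (simp add: emeasure_notin_sets)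
qed

lemma nn_integral_add_measure:
  assumes [measurable_cong]: "sets \<nu> = sets \<mu>" and "f \<in> borel_measurable \<mu>"
  shows "(\<integral>\<^sup>+x. f x \<partial>add_measure \<mu> \<nu>) = (\<integral>\<^sup>+x. f x \<partial>\<mu>) + (\<integral>\<^sup>+x. f x \<partial>\<nu>)"
  using assms(2)
proof (induction rule: borel_measurable_induct)
  case (cong f g)
  have "space \<nu> = space \<mu>" using assms(1) by (rule sets_eq_imp_space_eq)
  then have "(\<integral>\<^sup>+x. f x \<partial>M) = (\<integral>\<^sup>+x. g x \<partial>M)" if "M \<in> {\<mu>, \<nu>, add_measure \<mu> \<nu>}" for M
    using that cong(3) by (intro nn_integral_cong) auto
  then show ?case using cong by simp
next
  case (set B)
  then show ?case
    by (simp add: emeasure_add_measure assms(1))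
next
  case (mult u c)
  then show ?case by (simp add: nn_integral_cmult distrib_left)
next
  case (add u v)
  then show ?case by (simp add: nn_integral_add ac_simps)
next
  case (seq U)
  \<comment> \<open>In the limit step both sequences of integrals increase along the same index, so
    the supremum of their sums is the sum of their suprema.\<close>
  have inc: "incseq (\<lambda>i. integral\<^sup>N M (U i))" for M
    using seq(3) by (auto simp: mono_def le_fun_def intro!: nn_integral_mono)
  have 1: "integral\<^sup>N M (\<lambda>x. Sup (range U) x) = (SUP i. integral\<^sup>N M (U i))"
    if [measurable_cong]: "sets M = sets \<mu>" for M
    using seq(1,3) by (simp add: nn_integral_monotone_convergence_SUP image_comp SUP_apply cong: measurable_cong_sets[OF that refl])
  have "(SUP i. integral\<^sup>N (add_measure \<mu> \<nu>) (U i)) =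
      (SUP i. integral\<^sup>N \<mu> (U i) + integral\<^sup>N \<nu> (U i))"
    by (simp add: seq.IH)
  also have "\<dots> = (SUP i. integral\<^sup>N \<mu> (U i)) + (SUP i. integral\<^sup>N \<nu> (U i))"
    by (rule ennreal_SUP_add[OF inc inc])
  finally show ?case
    using 1[of \<mu>] 1[of \<nu>] 1[of "add_measure \<mu> \<nu>"] assms(1) by simp
qed

lemma integrable_add_measure:
  fixes f :: "'a \<Rightarrow> real"
  assumes [measurable_cong]: "sets \<nu> = sets \<mu>" and f: "integrable \<mu> f" "integrable \<nu> f"
  shows "integrable (add_measure \<mu> \<nu>) f"
    and "(\<integral>x. f x \<partial>add_measure \<mu> \<nu>) = (\<integral>x. f x \<partial>\<mu>) + (\<integral>x. f x \<partial>\<nu>)"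
proof -
  have [measurable]: "f \<in> borel_measurable \<mu>" using f by auto
  note nn = nn_integral_add_measure[OF assms(1)]
  show int: "integrable (add_measure \<mu> \<nu>) f"
    using f by (simp add: integrable_iff_bounded nn)
  \<comment> \<open>\<open>enn2real\<close> is additive only on finite values, so the integrals of
    the positive and of the negative part both have to be finite.\<close>
  have fin: "(\<integral>\<^sup>+x. ennreal (f x) \<partial>M) < top" "(\<integral>\<^sup>+x. ennreal (- f x) \<partial>M) < top"
    if "integrable M f" for M
    using that by (auto simp: real_integrable_def less_top)
  show "(\<integral>x. f x \<partial>add_measure \<mu> \<nu>) = (\<integral>x. f x \<partial>\<mu>) + (\<integral>x. f x \<partial>\<nu>)"
    using fin[OF f(1)] fin[OF f(2)]
    by (simp add: real_lebesgue_integral_def int f nn enn2real_plus)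
qed

lemma integral_scale_measure:
  fixes f :: "'a \<Rightarrow> real"
  assumes "integrable M f" "0 \<le> c"
  shows "integrable (scale_measure (ennreal c) M) f"
    and "(\<integral>x. f x \<partial>scale_measure (ennreal c) M) = c * (\<integral>x. f x \<partial>M)"
proof -
  have [measurable]: "f \<in> borel_measurable M" using assms by auto
  show int: "integrable (scale_measure (ennreal c) M) f"
    using assms by (simp add: integrable_iff_bounded nn_integral_scale_measure ennreal_mult_less_top)
  show "(\<integral>x. f x \<partial>scale_measure (ennreal c) M) = c * (\<integral>x. f x \<partial>M)"
    using assms
    by (simp add: real_lebesgue_integral_def int nn_integral_scale_measure enn2real_mult algebra_simps)
qed

section \<open>Relative measures and their representatives\<close>

definition rel_class :: "'a::metric_space set \<Rightarrow> 'a measure \<Rightarrow> 'a rel_measure" where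
  "rel_class A \<mu> = rel_equiv A `` {\<mu>}"

text \<open>The membership conditions of \<open>M1_plus\<close>, read on a single Borel measure.
  They concern only Borel subsets of \<open>- A\<close> and an integrand vanishing on
  \<open>A\<close>, so the mass carried by \<open>A\<close> is arbitrary, possibly infinite.\<close>

definition representatives :: "'a::metric_space set \<Rightarrow> 'a measure set" where
  "representatives A = {\<mu>. sets \<mu> = sets borel \<and>
     (\<forall>E\<in>sets borel. E \<subseteq> - A \<longrightarrow>
        emeasure \<mu> E = (SUP K\<in>{K. compact K \<and> K \<subseteq> E}. emeasure \<mu> K)) \<and>
     (\<integral>\<^sup>+x. ennreal (infdist x A) \<partial>\<mu>) < \<infinity>}"

text \<open>A class of integrands wide enough to be stable under multiplication by bounded Borel
  functions, in particular by indicators, which Lipschitz functions are not. The bound forces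
  vanishing on \<open>A\<close> and integrability against every representative.\<close>

definition dist_dominated :: "'a::metric_space set \<Rightarrow> ('a \<Rightarrow> real) set" where
  "dist_dominated A = {g \<in> borel_measurable borel. \<exists>C. \<forall>x. \<bar>g x\<bar> \<le> C * infdist x A}"

text \<open>The finite measure with density \<open>infdist x A\<close>, as a real-valued set
  function, so that weights can be subtracted and compared by real arithmetic.\<close>

definition weight :: "'a::metric_space set \<Rightarrow> 'a rel_measure \<Rightarrow> 'a set \<Rightarrow> real" where
  "weight A M E = rel_integral M (\<lambda>x. indicator E x * infdist x A)"

section \<open>Functions bounded by a multiple of the distance to \<open>A\<close>\<close>

lemma borel_measurable_infdist [measurable]:
  "(\<lambda>x. infdist x A) \<in> borel_measurable borel"
  by (intro borel_measurable_continuous_onI continuous_intros)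

lemma dist_dominated_add:
  "f \<in> dist_dominated A \<Longrightarrow> g \<in> dist_dominated A \<Longrightarrow> (\<lambda>x. f x + g x) \<in> dist_dominated A"
  unfolding dist_dominated_def
proof (clarsimp, intro exI allI)
  fix C D x
  assume "\<forall>x. \<bar>f x\<bar> \<le> C * infdist x A" "\<forall>x. \<bar>g x\<bar> \<le> D * infdist x A"
  then have "\<bar>f x\<bar> \<le> C * infdist x A" "\<bar>g x\<bar> \<le> D * infdist x A" by auto
  then show "\<bar>f x + g x\<bar> \<le> (C + D) * infdist x A" by (simp add: algebra_simps)
qed

lemma dist_dominated_mult:
  assumes f: "f \<in> dist_dominated A" and h: "h \<in> borel_measurable borel" "\<And>x. \<bar>h x\<bar> \<le> B"
  shows "(\<lambda>x. h x * f x) \<in> dist_dominated A"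
proof -
  obtain C where C: "\<And>x. \<bar>f x\<bar> \<le> C * infdist x A" and [measurable]: "f \<in> borel_measurable borel"
    using f by (auto simp: dist_dominated_def)
  have "\<bar>h x * f x\<bar> \<le> B * C * infdist x A" for x
    using mult_mono[OF h(2) C, of x x] order_trans[OF abs_ge_zero h(2)] by (simp add: abs_mult ac_simps)
  then show ?thesis using h(1) by (auto simp: dist_dominated_def)
qed

lemma dist_dominated_cmult: "f \<in> dist_dominated A \<Longrightarrow> (\<lambda>x. c * f x) \<in> dist_dominated A"
  by (rule dist_dominated_mult[where B = "\<bar>c\<bar>"]) auto

lemma dist_dominated_infdist: "(\<lambda>x. infdist x A) \<in> dist_dominated A"
  by (auto simp: dist_dominated_def intro!: exI[of _ 1] infdist_nonneg)

lemma dist_dominated_indicator: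
  "f \<in> dist_dominated A \<Longrightarrow> E \<in> sets borel \<Longrightarrow> (\<lambda>x. indicator E x * f x) \<in> dist_dominated A"
  by (rule dist_dominated_mult[where B = 1]) (auto split: split_indicator)

lemma dist_dominated_zero_on: "f \<in> dist_dominated A \<Longrightarrow> x \<in> A \<Longrightarrow> f x = 0"
  unfolding dist_dominated_def by (auto dest!: spec[of _ x])

lemma integrable_dist_dominated:
  assumes \<mu>: "\<mu> \<in> representatives A" and f: "f \<in> dist_dominated A"
  shows "integrable \<mu> f"
proof -
  obtain C where C: "\<And>x. \<bar>f x\<bar> \<le> C * infdist x A" and f_borel: "f \<in> borel_measurable borel"
    using f by (auto simp: dist_dominated_def)
  have [measurable_cong]: "sets \<mu> = sets borel" using \<mu> by (simp add: representatives_def)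
  have "integrable \<mu> (\<lambda>x. infdist x A)"
    using \<mu> by (simp add: integrable_iff_bounded representatives_def infdist_nonneg)
  then have "integrable \<mu> (\<lambda>x. C * infdist x A)" by simp
  then show ?thesis
    by (rule Bochner_Integration.integrable_bound) (use C f_borel order_trans[OF C abs_ge_self] in auto)
qed

definition diff_class :: "'a::metric_space set \<Rightarrow> 'a rel_measure \<Rightarrow> 'a rel_measure \<Rightarrow> 'a rel_diff" where
  "diff_class A M N = diff_equiv A `` {(M, N)}"

lemma order_nullE:
  assumes "order_null V D r x"
  obtains y where "x ` D \<subseteq> carr V" "y ` D \<subseteq> carr V"
    "\<And>i j. i \<in> D \<Longrightarrow> j \<in> D \<Longrightarrow> r i j \<Longrightarrow> vleq V (y j) (y i)"
    "is_inf V (y ` D) (vzero V)"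
    "\<And>i. i \<in> D \<Longrightarrow> \<exists>a. is_abs V (x i) a \<and> vleq V a (y i)"
  using assms unfolding order_null_def by blast

text \<open>The support of \<open>h\<close> is a closed subset of the union of the two compact
  supports. The hypothesis on common zeros serves maximum and minimum alike.\<close>

lemma compact_support_combine:
  fixes f g h :: "'a::metric_space \<Rightarrow> real"
  assumes "compact (closure {x. f x \<noteq> 0})" "compact (closure {x. g x \<noteq> 0})"
    and "\<And>x. f x = 0 \<Longrightarrow> g x = 0 \<Longrightarrow> h x = 0"
  shows "compact (closure {x. h x \<noteq> 0})"
proof -
  have "closure {x. h x \<noteq> 0} \<subseteq> closure {x. f x \<noteq> 0} \<union> closure {x. g x \<noteq> 0}"
    unfolding closure_Un[symmetric] using assms(3) by (intro closure_mono) auto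
  then have "closure {x. h x \<noteq> 0} =
      (closure {x. f x \<noteq> 0} \<union> closure {x. g x \<noteq> 0}) \<inter> closure {x. h x \<noteq> 0}"
    by auto
  also have "compact \<dots>"
    using assms(1,2) by (intro compact_Int_closed compact_Un) auto
  finally show ?thesis .
qed

locale metric_pair =
  fixes A :: "'a::metric_space set"
  assumes closed_A: "closed A" and A_nonempty: "A \<noteq> {}"
begin

section \<open>Classes of measures as restrictions to the complement of \<open>A\<close>\<close>

lemma infdist_pos_iff: "0 < infdist x A \<longleftrightarrow> x \<notin> A"
  using infdist_pos_not_in_closed[OF closed_A A_nonempty] infdist_zero[of x A] by auto

lemma compl_borel [measurable]: "- A \<in> sets borel" "A \<in> sets borel"
  using closed_A by auto

text \<open>The restriction to \<open>- A\<close> is a complete invariant of the class. Measures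
  concentrated on \<open>A\<close> do not affect it; conversely, two measures with the same
  restriction get equal sums when each receives the part of the other on \<open>A\<close>, which
  avoids subtracting infinite values.\<close>

lemma rel_equiv_iff:
  "(\<mu>, \<nu>) \<in> rel_equiv A \<longleftrightarrow> sets \<mu> = sets borel \<and> sets \<nu> = sets borel \<and>
     density \<mu> (indicator (- A)) = density \<nu> (indicator (- A))" (is "_ \<longleftrightarrow> ?R")
proof
  assume "(\<mu>, \<nu>) \<in> rel_equiv A"
  then obtain \<sigma> \<tau> where sets [simp]: "sets \<mu> = sets borel" "sets \<nu> = sets borel"
      "sets \<sigma> = sets borel" "sets \<tau> = sets borel"
    and conc: "emeasure \<sigma> (- A) = 0" "emeasure \<tau> (- A) = 0"
    and eq: "add_measure \<mu> \<sigma> = add_measure \<nu> \<tau>"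
    by (auto simp: rel_equiv_def borel_measures_on_def borel_measures_def)
  note [measurable_cong] = sets
  have "emeasure (density \<mu> (indicator (- A))) E = emeasure (density \<nu> (indicator (- A))) E"
    if E: "E \<in> sets borel" for E
  proof -
    have "emeasure \<sigma> (- A \<inter> E) = 0" "emeasure \<tau> (- A \<inter> E) = 0"
      using conc by (auto intro!: emeasure_eq_0[where N = "- A"] compl_borel)
    then have "emeasure \<mu> (- A \<inter> E) = emeasure \<nu> (- A \<inter> E)"
      using arg_cong[OF eq, of "\<lambda>M. emeasure M (- A \<inter> E)"] by (simp add: emeasure_add_measure)
    then show ?thesis using E by (simp add: emeasure_density flip: indicator_inter_arith)
  qed
  then show ?R by (auto intro: measure_eqI)
next
  assume R: ?R
  then have sets [simp, measurable_cong]: "sets \<mu> = sets borel" "sets \<nu> = sets borel" by auto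
  have split: "emeasure M E = emeasure (density M (indicator (- A))) E + emeasure (density M (indicator A)) E"
    if [measurable_cong]: "sets M = sets borel" and E [measurable]: "E \<in> sets borel" for M :: "'a measure" and E
  proof -
    have "emeasure M ((- A \<inter> E) \<union> (A \<inter> E)) = emeasure M (- A \<inter> E) + emeasure M (A \<inter> E)"
      by (rule plus_emeasure[symmetric]) auto
    moreover have "(- A \<inter> E) \<union> (A \<inter> E) = E" by auto
    ultimately show ?thesis using E that by (simp add: emeasure_density flip: indicator_inter_arith)
  qed
  have "add_measure \<mu> (density \<nu> (indicator A)) = add_measure \<nu> (density \<mu> (indicator A))"
  proof (rule measure_eqI)
    fix E assume "E \<in> sets (add_measure \<mu> (density \<nu> (indicator A)))"
    then have "E \<in> sets borel" by simp
    then show "emeasure (add_measure \<mu> (density \<nu> (indicator A))) E =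
        emeasure (add_measure \<nu> (density \<mu> (indicator A))) E"
      using R by (simp add: emeasure_add_measure split[of \<mu>] split[of \<nu>] ac_simps)
  qed simp
  moreover have "density M (indicator A) \<in> borel_measures_on A"
    if [measurable_cong]: "sets M = sets borel" for M :: "'a measure"
    using that compl_borel
    by (simp add: borel_measures_on_def borel_measures_def emeasure_density flip: indicator_inter_arith)
  ultimately show "(\<mu>, \<nu>) \<in> rel_equiv A"
    unfolding rel_equiv_def borel_measures_def using sets by blast
qed

lemma equiv_rel_equiv: "equiv borel_measures (rel_equiv A)"
  by (rule equivI)
    (auto simp: refl_on_def sym_def trans_def rel_equiv_iff borel_measures_def)

lemma rel_class_eq_iff:
  assumes "sets \<mu> = sets borel" "sets \<nu> = sets borel"
  shows "rel_class A \<mu> = rel_class A \<nu> \<longleftrightarrow>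
    density \<mu> (indicator (- A)) = density \<nu> (indicator (- A))"
  using eq_equiv_class_iff[OF equiv_rel_equiv, of \<mu> \<nu>] assms
  by (auto simp: rel_class_def rel_equiv_iff borel_measures_def)

lemma in_rel_class_iff:
  assumes "sets \<mu> = sets borel"
  shows "\<nu> \<in> rel_class A \<mu> \<longleftrightarrow> sets \<nu> = sets borel \<and>
    density \<mu> (indicator (- A)) = density \<nu> (indicator (- A))"
  using assms by (auto simp: rel_class_def rel_equiv_iff)

text \<open>A quantity that depends only on the restriction to \<open>- A\<close> is constant on
  each class, so \<open>the_elem\<close> is applied to a singleton.\<close>

lemma the_elem_rel_class:
  assumes "sets \<mu> = sets borel"
    and "\<And>\<nu>. sets \<nu> = sets borel \<Longrightarrow> f \<nu> = g (density \<nu> (indicator (- A)))"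
  shows "the_elem (f ` rel_class A \<mu>) = f \<mu>"
proof -
  have "f ` rel_class A \<mu> = {f \<mu>}"
    using assms by (force simp: in_rel_class_iff)
  then show ?thesis by simp
qed

lemma rel_emeasure_rel_class:
  assumes "sets \<mu> = sets borel" "E \<in> sets borel" "E \<subseteq> - A"
  shows "rel_emeasure (rel_class A \<mu>) E = emeasure \<mu> E"
  unfolding rel_emeasure_def
proof (rule the_elem_rel_class)
  fix \<nu> :: "'a measure" assume \<nu> [measurable_cong]: "sets \<nu> = sets borel"
  have "- A \<inter> E = E" using assms by auto
  then show "emeasure \<nu> E = emeasure (density \<nu> (indicator (- A))) E"
    using assms \<nu> by (simp add: emeasure_density flip: indicator_inter_arith)
qed fact

lemma rel_nn_integral_rel_class:
  assumes "sets \<mu> = sets borel" "f \<in> borel_measurable borel" "\<And>x. x \<in> A \<Longrightarrow> f x = 0"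
  shows "rel_nn_integral (rel_class A \<mu>) f = (\<integral>\<^sup>+x. f x \<partial>\<mu>)"
  unfolding rel_nn_integral_def
proof (rule the_elem_rel_class)
  fix \<nu> :: "'a measure" assume \<nu> [measurable_cong]: "sets \<nu> = sets borel"
  note [measurable] = assms(2)
  show "(\<integral>\<^sup>+x. f x \<partial>\<nu>) = (\<integral>\<^sup>+x. f x \<partial>density \<nu> (indicator (- A)))"
    using assms(3) by (subst nn_integral_density) (auto intro!: nn_integral_cong split: split_indicator)
qed fact

lemma rel_integral_rel_class:
  assumes "sets \<mu> = sets borel" "f \<in> dist_dominated A"
  shows "rel_integral (rel_class A \<mu>) f = (\<integral>x. f x \<partial>\<mu>)"
  unfolding rel_integral_def
proof (rule the_elem_rel_class)
  fix \<nu> :: "'a measure" assume \<nu> [measurable_cong]: "sets \<nu> = sets borel"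
  have [measurable]: "f \<in> borel_measurable borel" using assms(2) by (simp add: dist_dominated_def)
  \<comment> \<open>If \<open>f\<close> is not integrable, the identity still holds, since both
    integrals then have the default value 0.\<close>
  have "(\<integral>x. f x \<partial>density \<nu> (\<lambda>x. ennreal (indicator (- A) x))) = (\<integral>x. indicator (- A) x *\<^sub>R f x \<partial>\<nu>)"
    by (rule integral_density) auto
  also have "\<dots> = (\<integral>x. f x \<partial>\<nu>)"
    using dist_dominated_zero_on[OF assms(2)]
    by (intro Bochner_Integration.integral_cong) (auto split: split_indicator)
  finally show "(\<integral>x. f x \<partial>\<nu>) = (\<integral>x. f x \<partial>density \<nu> (indicator (- A)))"
    by (simp add: ennreal_indicator)
qed fact

text \<open>Compact subsets of a set disjoint from \<open>A\<close> are disjoint from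
  \<open>A\<close>, and \<open>infdist\<close> vanishes on \<open>A\<close>; so each condition on
  the class can be evaluated on the given representative.\<close>

lemma rel_class_in_M1_plus_iff:
  assumes \<mu>: "sets \<mu> = sets borel"
  shows "rel_class A \<mu> \<in> M1_plus A \<longleftrightarrow> \<mu> \<in> representatives A"
proof -
  have "rel_class A \<mu> \<in> rel_measures A"
    using \<mu> by (auto simp: rel_measures_def rel_class_def borel_measures_def intro: quotientI)
  moreover have "rel_nn_integral (rel_class A \<mu>) (\<lambda>x. ennreal (infdist x A)) = (\<integral>\<^sup>+x. ennreal (infdist x A) \<partial>\<mu>)"
    using \<mu> by (rule rel_nn_integral_rel_class) auto
  moreover have "(SUP K\<in>{K. compact K \<and> K \<subseteq> E}. rel_emeasure (rel_class A \<mu>) K) =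
      (SUP K\<in>{K. compact K \<and> K \<subseteq> E}. emeasure \<mu> K)" if "E \<subseteq> - A" for E
    using that \<mu> by (intro SUP_cong refl rel_emeasure_rel_class) (auto intro: borel_compact)
  ultimately show ?thesis
    using \<mu> by (auto simp: M1_plus_def representatives_def rel_tight_def rel_emeasure_rel_class)
qed

lemma M1_plus_eq: "M1_plus A = rel_class A ` representatives A"
proof (intro equalityI subsetI)
  fix M assume M: "M \<in> M1_plus A"
  then obtain \<mu> where "M = rel_class A \<mu>" "sets \<mu> = sets borel"
    by (auto simp: M1_plus_def rel_measures_def quotient_def rel_class_def borel_measures_def)
  then show "M \<in> rel_class A ` representatives A" using M rel_class_in_M1_plus_iff by auto
next
  fix M assume "M \<in> rel_class A ` representatives A"
  then show "M \<in> M1_plus A" using rel_class_in_M1_plus_iff by (auto simp: representatives_def)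
qed

text \<open>Restriction to \<open>- A\<close> commutes with sums, so the unions in
  \<open>rel_add\<close> run over nonempty classes and all their terms are the same class.\<close>

lemma rel_add_rel_class:
  assumes [simp, measurable_cong]: "sets \<mu> = sets borel" "sets \<nu> = sets borel"
  shows "rel_add A (rel_class A \<mu>) (rel_class A \<nu>) = rel_class A (add_measure \<mu> \<nu>)"
proof -
  have "rel_class A (add_measure \<mu>' \<nu>') = rel_class A (add_measure \<mu> \<nu>)"
    if "\<mu>' \<in> rel_class A \<mu>" "\<nu>' \<in> rel_class A \<nu>" for \<mu>' \<nu>'
  proof -
    from that have [simp, measurable_cong]: "sets \<mu>' = sets borel" "sets \<nu>' = sets borel"
      and eq: "density \<mu> (indicator (- A)) = density \<mu>' (indicator (- A))"
        "density \<nu> (indicator (- A)) = density \<nu>' (indicator (- A))"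
      by (auto simp: in_rel_class_iff)
    have "density (add_measure \<mu> \<nu>) (indicator (- A)) = density (add_measure \<mu>' \<nu>') (indicator (- A))"
    proof (rule measure_eqI)
      fix E assume "E \<in> sets (density (add_measure \<mu> \<nu>) (indicator (- A)))"
      then have E [measurable]: "E \<in> sets borel" by simp
      show "emeasure (density (add_measure \<mu> \<nu>) (indicator (- A))) E =
          emeasure (density (add_measure \<mu>' \<nu>') (indicator (- A))) E"
        using arg_cong[OF eq(1), of "\<lambda>M. emeasure M E"] arg_cong[OF eq(2), of "\<lambda>M. emeasure M E"] E
        by (simp add: emeasure_density nn_integral_add_measure)
    qed simp
    then show ?thesis by (simp add: rel_class_eq_iff)
  qed
  moreover have "\<mu> \<in> rel_class A \<mu>" "\<nu> \<in> rel_class A \<nu>"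
    by (auto simp: in_rel_class_iff)
  ultimately show ?thesis
    unfolding rel_add_def rel_class_def[of _ "add_measure _ _", symmetric] by blast
qed

lemma rel_scale_rel_class:
  assumes [simp, measurable_cong]: "sets \<mu> = sets borel"
  shows "rel_scale A c (rel_class A \<mu>) = rel_class A (scale_measure (ennreal c) \<mu>)"
proof -
  have "rel_class A (scale_measure (ennreal c) \<mu>') = rel_class A (scale_measure (ennreal c) \<mu>)"
    if "\<mu>' \<in> rel_class A \<mu>" for \<mu>'
  proof -
    from that have [simp, measurable_cong]: "sets \<mu>' = sets borel"
      and eq: "density \<mu> (indicator (- A)) = density \<mu>' (indicator (- A))"
      by (auto simp: in_rel_class_iff)
    have "density (scale_measure (ennreal c) \<mu>) (indicator (- A)) =
        density (scale_measure (ennreal c) \<mu>') (indicator (- A))"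
    proof (rule measure_eqI)
      fix E assume "E \<in> sets (density (scale_measure (ennreal c) \<mu>) (indicator (- A)))"
      then have E [measurable]: "E \<in> sets borel" by simp
      show "emeasure (density (scale_measure (ennreal c) \<mu>) (indicator (- A))) E =
          emeasure (density (scale_measure (ennreal c) \<mu>') (indicator (- A))) E"
        using arg_cong[OF eq, of "\<lambda>M. emeasure M E"] E
        by (simp add: emeasure_density nn_integral_scale_measure)
    qed simp
    then show ?thesis by (simp add: rel_class_eq_iff)
  qed
  moreover have "\<mu> \<in> rel_class A \<mu>"
    by (auto simp: in_rel_class_iff)
  ultimately show ?thesis
    unfolding rel_scale_def rel_class_def[of _ "scale_measure _ _", symmetric] by blast
qed

section \<open>Multiplying and dividing by the distance to \<open>A\<close>\<close>

lemma ennreal_infdist_inverse: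
  "ennreal (infdist x A) * ennreal (1 / infdist x A) = indicator (- A) x"
\<comment> \<open>On \<open>A\<close> the distance is 0 and division by zero gives 0, so the product
  vanishes there.\<close>
proof (cases "x \<in> A")
  case False
  then show ?thesis
    using infdist_pos_iff[of x] by (simp add: infdist_nonneg flip: ennreal_mult)
qed simp

text \<open>Both orders are used: multiplying first recovers a relative measure from its weight,
  dividing first realises a measure without mass on \<open>A\<close> as a weight.\<close>

lemma density_infdist_inverse:
  assumes [measurable_cong]: "sets \<mu> = sets borel"
  shows "density (density \<mu> (\<lambda>x. ennreal (infdist x A))) (\<lambda>x. ennreal (1 / infdist x A)) =
      density \<mu> (indicator (- A))"
    and "density (density \<mu> (\<lambda>x. ennreal (1 / infdist x A))) (\<lambda>x. ennreal (infdist x A)) =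
      density \<mu> (indicator (- A))"
proof -
  show "density (density \<mu> (\<lambda>x. ennreal (infdist x A))) (\<lambda>x. ennreal (1 / infdist x A)) =
      density \<mu> (indicator (- A))"
    by (subst density_density_eq) (auto simp: ennreal_infdist_inverse)
  show "density (density \<mu> (\<lambda>x. ennreal (1 / infdist x A))) (\<lambda>x. ennreal (infdist x A)) =
      density \<mu> (indicator (- A))"
    by (subst density_density_eq) (auto simp: ennreal_infdist_inverse mult.commute)
qed

lemma dist_dominated_weight:
  "E \<in> sets borel \<Longrightarrow> (\<lambda>x. indicator E x * infdist x A) \<in> dist_dominated A"
  by (intro dist_dominated_indicator dist_dominated_infdist)

lemma sets_representative: "\<mu> \<in> representatives A \<Longrightarrow> sets \<mu> = sets borel"
  by (simp add: representatives_def)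

text \<open>Identifies \<open>weight\<close> with a genuine measure, which is finite because the
  left side is the \<open>ennreal\<close> of a real number; continuity along decreasing sets thus
  becomes available.\<close>

lemma ennreal_weight:
  assumes \<mu>: "\<mu> \<in> representatives A" and E: "E \<in> sets borel"
  shows "ennreal (weight A (rel_class A \<mu>) E) = emeasure (density \<mu> (\<lambda>x. ennreal (infdist x A))) E"
proof -
  note [measurable_cong] = sets_representative[OF \<mu>]
  have "ennreal (weight A (rel_class A \<mu>) E) = ennreal (\<integral>x. indicator E x * infdist x A \<partial>\<mu>)"
    using \<mu> E by (simp add: weight_def rel_integral_rel_class sets_representative dist_dominated_weight)
  also have "\<dots> = (\<integral>\<^sup>+x. ennreal (indicator E x * infdist x A) \<partial>\<mu>)"
    using integrable_dist_dominated[OF \<mu> dist_dominated_weight[OF E]]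
    by (intro nn_integral_eq_integral[symmetric]) (auto simp: infdist_nonneg)
  also have "\<dots> = (\<integral>\<^sup>+x. ennreal (infdist x A) * indicator E x \<partial>\<mu>)"
    by (intro nn_integral_cong) (auto split: split_indicator)
  finally show ?thesis
    using E by (simp add: emeasure_density sets_representative[OF \<mu>])
qed

text \<open>Markov's inequality for the distance to \<open>A\<close>: the indicator of the set is at
  most \<open>infdist x A / c\<close>.\<close>

lemma emeasure_away_from_A_finite:
  assumes \<mu>: "\<mu> \<in> representatives A" and c: "0 < c"
  shows "emeasure \<mu> {x. c < infdist x A} < \<infinity>"
proof -
  note [measurable_cong] = sets_representative[OF \<mu>]
  have meas: "{x. c < infdist x A} \<in> sets \<mu>" by (simp add: sets_representative[OF \<mu>])
  have "emeasure \<mu> {x. c < infdist x A} = (\<integral>\<^sup>+x. indicator {x. c < infdist x A} x \<partial>\<mu>)"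
    using meas by simp
  also have "\<dots> \<le> (\<integral>\<^sup>+x. ennreal (1 / c) * ennreal (infdist x A) \<partial>\<mu>)"
    using c by (intro nn_integral_mono) (auto simp: divide_simps simp flip: ennreal_mult split: split_indicator)
  also have "\<dots> = ennreal (1 / c) * (\<integral>\<^sup>+x. ennreal (infdist x A) \<partial>\<mu>)"
    by (rule nn_integral_cmult) simp
  also have "\<dots> < \<infinity>"
    using \<mu> by (simp add: representatives_def ennreal_mult_less_top)
  finally show ?thesis .
qed

text \<open>A Borel subset of \<open>- A\<close> may have infinite measure, so tightness is transferred on the sets
  of points at distance more than \<open>1 / (n + 1)\<close> from \<open>A\<close>, which have finite measure.\<close>

lemma representatives_mono:
  assumes \<mu>: "\<mu> \<in> representatives A" and \<nu>: "sets \<nu> = sets borel"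
    and le: "\<And>E. E \<in> sets borel \<Longrightarrow> E \<subseteq> - A \<Longrightarrow> emeasure \<nu> E \<le> emeasure \<mu> E"
    and fin: "(\<integral>\<^sup>+x. ennreal (infdist x A) \<partial>\<nu>) < \<infinity>"
  shows "\<nu> \<in> representatives A"
  unfolding representatives_def
proof (intro CollectI conjI ballI impI \<nu> fin antisym)
  fix E assume E: "E \<in> sets borel" "E \<subseteq> - A"
  let ?S = "SUP K\<in>{K. compact K \<and> K \<subseteq> E}. emeasure \<nu> K"
  show "?S \<le> emeasure \<nu> E"
    using E \<nu> by (intro SUP_least emeasure_mono) auto
  define F where "F n = E \<inter> {x. 1 / real (Suc n) < infdist x A}" for n
  have F: "F n \<in> sets borel" "F n \<subseteq> - A" for n
    using E by (auto simp: F_def)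
  have inc: "incseq F"
  proof (intro monoI subsetI)
    fix m n :: nat and x assume "m \<le> n" "x \<in> F m"
    moreover from this have "1 / real (Suc n) \<le> 1 / real (Suc m)" by (simp add: frac_le)
    ultimately show "x \<in> F n" by (auto simp: F_def)
  qed
  have UN: "(\<Union>n. F n) = E"
  proof (intro equalityI subsetI)
    fix x assume x: "x \<in> E"
    then have "0 < infdist x A" using E infdist_pos_iff by auto
    then obtain n where "1 / real (Suc n) < infdist x A"
      using nat_approx_posE by blast
    then show "x \<in> (\<Union>n. F n)" using x by (auto simp: F_def)
  qed (auto simp: F_def)
  have "range F \<subseteq> sets \<nu>" using F \<nu> by auto
  then have "emeasure \<nu> E = (SUP n. emeasure \<nu> (F n))"
    using SUP_emeasure_incseq[of F \<nu>] inc UN by simp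
  also have "\<dots> \<le> ?S"
  proof (rule SUP_least, rule ennreal_le_epsilon)
    fix n and e :: real assume e: "0 < e"
    have "emeasure \<mu> (F n) \<le> emeasure \<mu> {x. 1 / real (Suc n) < infdist x A}"
      by (rule emeasure_mono) (auto simp: F_def sets_representative[OF \<mu>])
    also have "\<dots> < \<infinity>" using \<mu> by (rule emeasure_away_from_A_finite) simp
    finally have fin_F: "emeasure \<mu> (F n) < \<infinity>" .
    have "emeasure \<mu> (F n) = (SUP K\<in>{K. compact K \<and> K \<subseteq> F n}. emeasure \<mu> K)"
      using \<mu> F by (simp add: representatives_def)
    from SUP_approx_ennreal[OF e _ this]
    have "\<exists>K\<in>{K. compact K \<and> K \<subseteq> F n}. emeasure \<mu> (F n) < emeasure \<mu> K + ennreal e"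
      using fin_F by (force simp: less_top)
    then obtain K where K: "compact K" "K \<subseteq> F n" "emeasure \<mu> (F n) \<le> emeasure \<mu> K + ennreal e"
      by (auto intro: less_imp_le)
    have K_borel: "K \<in> sets borel" using K by (simp add: borel_compact)
    \<comment> \<open>The compact set chosen for \<open>\<mu>\<close> also serves
      \<open>\<nu>\<close>: only the remainder \<open>F n - K\<close> is compared, and there
      \<open>\<nu>\<close> is at most \<open>\<mu>\<close>.\<close>
    have "emeasure \<mu> (F n - K) \<le> ennreal e"
    proof -
      have "emeasure \<mu> K < \<infinity>" using emeasure_mono[of K "F n" \<mu>] K F fin_F by (auto simp: sets_representative[OF \<mu>])
      then have "emeasure \<mu> (F n - K) = emeasure \<mu> (F n) - emeasure \<mu> K"
        using K K_borel F by (intro emeasure_Diff) (auto simp: sets_representative[OF \<mu>])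
      then show ?thesis using K(3) fin_F by (auto simp: ennreal_minus_le_iff ac_simps)
    qed
    then have "emeasure \<nu> (F n - K) \<le> ennreal e"
      using le[of "F n - K"] F K_borel by (auto intro: order_trans)
    moreover have "emeasure \<nu> (F n) = emeasure \<nu> K + emeasure \<nu> (F n - K)"
      using K F K_borel \<nu> plus_emeasure[of K \<nu> "F n - K"] by (auto simp: Un_absorb1)
    moreover have "emeasure \<nu> K \<le> ?S"
      using K F by (intro SUP_upper) (auto simp: F_def)
    ultimately show "emeasure \<nu> (F n) \<le> ?S + ennreal e"
      by (simp add: add_mono)
  qed
  finally show "emeasure \<nu> E \<le> ?S" .
qed

section \<open>Sums, multiples and integrals in the positive cone\<close>

lemma representatives_add:
  assumes \<mu>: "\<mu> \<in> representatives A" and \<nu>: "\<nu> \<in> representatives A"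
  shows "add_measure \<mu> \<nu> \<in> representatives A"
  unfolding representatives_def
proof (intro CollectI conjI ballI impI)
  note sets = sets_representative[OF \<mu>] sets_representative[OF \<nu>]
  show "sets (add_measure \<mu> \<nu>) = sets borel" by (simp add: sets)
  show "(\<integral>\<^sup>+x. ennreal (infdist x A) \<partial>add_measure \<mu> \<nu>) < \<infinity>"
    using \<mu> \<nu> sets by (subst nn_integral_add_measure) (auto simp: representatives_def cong: measurable_cong_sets)
  fix E assume E: "E \<in> sets borel" "E \<subseteq> - A"
  \<comment> \<open>The union of two compact subsets approximates both measures at once, so the
    supremum of the sums is the sum of the suprema.\<close>
  have "(SUP K\<in>{K. compact K \<and> K \<subseteq> E}. emeasure \<mu> K + emeasure \<nu> K) =
      (SUP K\<in>{K. compact K \<and> K \<subseteq> E}. emeasure \<mu> K) + (SUP K\<in>{K. compact K \<and> K \<subseteq> E}. emeasure \<nu> K)"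
  proof (rule SUP_add_directed_ennreal)
    fix K L assume "K \<in> {K. compact K \<and> K \<subseteq> E}" "L \<in> {K. compact K \<and> K \<subseteq> E}"
    then show "\<exists>J\<in>{K. compact K \<and> K \<subseteq> E}. emeasure \<mu> K + emeasure \<nu> L \<le> emeasure \<mu> J + emeasure \<nu> J"
      by (intro bexI[of _ "K \<union> L"] add_mono emeasure_mono) (auto simp: sets borel_compact)
  qed
  then show "emeasure (add_measure \<mu> \<nu>) E = (SUP K\<in>{K. compact K \<and> K \<subseteq> E}. emeasure (add_measure \<mu> \<nu>) K)"
    using \<mu> \<nu> E by (simp add: emeasure_add_measure sets representatives_def)
qed

lemma representatives_scale:
  assumes \<mu>: "\<mu> \<in> representatives A"
  shows "scale_measure (ennreal c) \<mu> \<in> representatives A"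
proof -
  have "(\<integral>\<^sup>+x. ennreal (infdist x A) \<partial>scale_measure (ennreal c) \<mu>) < \<infinity>"
    using \<mu> by (subst nn_integral_scale_measure)
      (auto simp: representatives_def ennreal_mult_less_top cong: measurable_cong_sets)
  then show ?thesis
    using \<mu> by (auto simp: representatives_def SUP_mult_left_ennreal)
qed

lemma M1_plus_add:
  assumes "M \<in> M1_plus A" "N \<in> M1_plus A"
  shows "rel_add A M N \<in> M1_plus A"
    and "f \<in> dist_dominated A \<Longrightarrow> rel_integral (rel_add A M N) f = rel_integral M f + rel_integral N f"
proof -
  obtain \<mu> \<nu> where reps: "\<mu> \<in> representatives A" "\<nu> \<in> representatives A"
    and MN: "M = rel_class A \<mu>" "N = rel_class A \<nu>"
    using assms by (auto simp: M1_plus_eq)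
  then have eq: "rel_add A M N = rel_class A (add_measure \<mu> \<nu>)"
    by (simp add: rel_add_rel_class sets_representative)
  show "rel_add A M N \<in> M1_plus A"
    using representatives_add[OF reps] by (auto simp: eq M1_plus_eq)
  show "rel_integral (rel_add A M N) f = rel_integral M f + rel_integral N f"
    if f: "f \<in> dist_dominated A"
    unfolding eq unfolding MN using reps f
    by (simp add: rel_integral_rel_class sets_representative integrable_dist_dominated integrable_add_measure)
qed

lemma M1_plus_scale:
  assumes "M \<in> M1_plus A" "0 \<le> c"
  shows "rel_scale A c M \<in> M1_plus A"
    and "f \<in> dist_dominated A \<Longrightarrow> rel_integral (rel_scale A c M) f = c * rel_integral M f"
proof -
  obtain \<mu> where rep: "\<mu> \<in> representatives A" and M: "M = rel_class A \<mu>"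
    using assms by (auto simp: M1_plus_eq)
  then have eq: "rel_scale A c M = rel_class A (scale_measure (ennreal c) \<mu>)"
    by (simp add: rel_scale_rel_class sets_representative)
  show "rel_scale A c M \<in> M1_plus A"
    using representatives_scale[OF rep] by (auto simp: eq M1_plus_eq)
  show "rel_integral (rel_scale A c M) f = c * rel_integral M f" if f: "f \<in> dist_dominated A"
    unfolding eq unfolding M using rep f assms(2)
    by (simp add: rel_integral_rel_class sets_representative integrable_dist_dominated integral_scale_measure)
qed

lemma rel_zero_eq: "rel_zero A = rel_class A (null_measure borel)"
  by (simp add: rel_zero_def rel_class_def)

lemma M1_plus_zero:
  shows "rel_zero A \<in> M1_plus A"
    and "f \<in> dist_dominated A \<Longrightarrow> rel_integral (rel_zero A) f = 0"
proof -
  have "(\<integral>\<^sup>+x. ennreal (infdist x A) \<partial>null_measure borel) = 0"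
    by (subst nn_integral_null_measure) simp
  moreover have "(SUP K\<in>S. (0::ennreal)) = 0" for S :: "'a set set"
    using SUP_bot[of S, where 'a = ennreal] by (simp add: bot_ennreal)
  ultimately have "null_measure borel \<in> representatives A"
    by (auto simp: representatives_def)
  then show "rel_zero A \<in> M1_plus A" by (auto simp: rel_zero_eq M1_plus_eq)
  show "rel_integral (rel_zero A) f = 0" if "f \<in> dist_dominated A"
    using that by (simp add: rel_zero_eq rel_integral_rel_class)
qed

lemma rel_integral_add:
  assumes "M \<in> M1_plus A" "f \<in> dist_dominated A" "g \<in> dist_dominated A"
  shows "rel_integral M (\<lambda>x. f x + g x) = rel_integral M f + rel_integral M g"
  using assms by (auto simp: M1_plus_eq rel_integral_rel_class sets_representative dist_dominated_add
      integrable_dist_dominated)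

lemma rel_integral_cmult:
  assumes "M \<in> M1_plus A" "f \<in> dist_dominated A"
  shows "rel_integral M (\<lambda>x. c * f x) = c * rel_integral M f"
  using assms by (auto simp: M1_plus_eq rel_integral_rel_class sets_representative dist_dominated_cmult)

lemma rel_integral_nonneg:
  assumes "M \<in> M1_plus A" "f \<in> dist_dominated A" "\<And>x. 0 \<le> f x"
  shows "0 \<le> rel_integral M f"
  using assms by (auto simp: M1_plus_eq rel_integral_rel_class sets_representative)

lemma weight_nonneg: "M \<in> M1_plus A \<Longrightarrow> E \<in> sets borel \<Longrightarrow> 0 \<le> weight A M E"
  unfolding weight_def by (intro rel_integral_nonneg dist_dominated_weight) (auto simp: infdist_nonneg)

text \<open>Dividing the weight by \<open>infdist\<close> recovers the restriction to
  \<open>- A\<close>. As weights are finite, identities in \<open>M1_plus\<close> become identities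
  of real numbers, where cancellation holds.\<close>

lemma M1_plus_eqI:
  assumes "M \<in> M1_plus A" "N \<in> M1_plus A" and eq: "\<And>E. E \<in> sets borel \<Longrightarrow> weight A M E = weight A N E"
  shows "M = N"
proof -
  obtain \<mu> \<nu> where reps: "\<mu> \<in> representatives A" "\<nu> \<in> representatives A"
    and MN: "M = rel_class A \<mu>" "N = rel_class A \<nu>"
    using assms by (auto simp: M1_plus_eq)
  note sets = sets_representative[OF reps(1)] sets_representative[OF reps(2)]
  have "density \<mu> (\<lambda>x. ennreal (infdist x A)) = density \<nu> (\<lambda>x. ennreal (infdist x A))"
  proof (rule measure_eqI)
    fix E assume "E \<in> sets (density \<mu> (\<lambda>x. ennreal (infdist x A)))"
    then have "E \<in> sets borel" by (simp add: sets)
    then show "emeasure (density \<mu> (\<lambda>x. ennreal (infdist x A))) E =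
        emeasure (density \<nu> (\<lambda>x. ennreal (infdist x A))) E"
      using eq[of E] reps by (simp add: MN flip: ennreal_weight)
  qed (simp add: sets)
  then show ?thesis
    by (metis MN density_infdist_inverse(1) rel_class_eq_iff sets)
qed

text \<open>The inverse construction: a Borel measure below a weight is itself a weight, namely that
  of the measure obtained by dividing by \<open>infdist\<close>.\<close>

lemma M1_plus_dominated:
  assumes M: "M \<in> M1_plus A" and F [simp, measurable_cong]: "sets F = sets borel"
    and le: "\<And>E. E \<in> sets borel \<Longrightarrow> emeasure F E \<le> ennreal (weight A M E)"
  obtains L where "L \<in> M1_plus A" "\<And>E. E \<in> sets borel \<Longrightarrow> ennreal (weight A L E) = emeasure F E"
proof -
  obtain \<mu> where rep: "\<mu> \<in> representatives A" and M_eq: "M = rel_class A \<mu>"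
    using M by (auto simp: M1_plus_eq)
  note sets [simp, measurable_cong] = sets_representative[OF rep]
  define \<nu> where "\<nu> = density F (\<lambda>x. ennreal (1 / infdist x A))"
  have sets_\<nu> [simp, measurable_cong]: "sets \<nu> = sets borel" by (simp add: \<nu>_def)
  \<comment> \<open>A weight vanishes on \<open>A\<close>, hence so does \<open>F\<close>; dividing
    by \<open>infdist\<close> and multiplying back then loses nothing.\<close>
  have "emeasure F A \<le> ennreal (weight A M A)" by (rule le) simp
  also have "\<dots> = (\<integral>\<^sup>+x. ennreal (infdist x A) * indicator A x \<partial>\<mu>)"
    using ennreal_weight[OF rep, of A] by (simp add: M_eq emeasure_density)
  also have "\<dots> = (\<integral>\<^sup>+x. 0 \<partial>\<mu>)"
    by (intro nn_integral_cong) (auto split: split_indicator)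
  finally have "A \<in> null_sets F" by (simp add: null_sets_def)
  then have "AE x in F. x \<notin> A" by (rule AE_not_in)
  then have "density F (indicator (- A)) = density F (\<lambda>_. 1)"
    by (intro density_cong) (auto elim!: eventually_mono)
  then have dens: "density \<nu> (\<lambda>x. ennreal (infdist x A)) = F"
    by (simp add: \<nu>_def density_infdist_inverse density_1)
  have "(\<integral>\<^sup>+x. ennreal (infdist x A) \<partial>\<nu>) = emeasure F UNIV"
    by (simp add: emeasure_density flip: dens)
  also have "\<dots> < \<infinity>" using le[of UNIV] by (auto intro: le_less_trans)
  finally have fin: "(\<integral>\<^sup>+x. ennreal (infdist x A) \<partial>\<nu>) < \<infinity>" .
  have "F \<le> density \<mu> (\<lambda>x. ennreal (infdist x A))"
  proof -
    have "emeasure F E \<le> emeasure (density \<mu> (\<lambda>x. ennreal (infdist x A))) E" for E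
      using le[of E] ennreal_weight[OF rep, of E]
      by (cases "E \<in> sets borel") (auto simp: M_eq emeasure_notin_sets)
    then show ?thesis
      using sets_eq_imp_space_eq[OF F] sets_eq_imp_space_eq[OF sets]
      by (auto simp: le_measure_iff le_fun_def)
  qed
  then have le': "integral\<^sup>N F f \<le> integral\<^sup>N (density \<mu> (\<lambda>x. ennreal (infdist x A))) f" for f
    by (intro nn_integral_mono_measure) simp
  \<comment> \<open>Dividing the inequality between \<open>F\<close> and the weight of
    \<open>M\<close> by \<open>infdist\<close> bounds \<open>\<nu>\<close> by \<open>\<mu>\<close>
    off \<open>A\<close>, so \<open>\<nu>\<close> inherits tightness.\<close>
  have rep': "\<nu> \<in> representatives A"
  proof (rule representatives_mono[OF rep sets_\<nu> _ fin])
    fix E assume E [measurable]: "E \<in> sets borel" and "E \<subseteq> - A"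
    then have "- A \<inter> E = E" by auto
    have "emeasure \<nu> E = (\<integral>\<^sup>+x. ennreal (1 / infdist x A) * indicator E x \<partial>F)"
      by (simp add: \<nu>_def emeasure_density)
    also have "\<dots> \<le> (\<integral>\<^sup>+x. ennreal (1 / infdist x A) * indicator E x \<partial>density \<mu> (\<lambda>x. ennreal (infdist x A)))"
      by (rule le')
    also have "\<dots> = emeasure (density (density \<mu> (\<lambda>x. ennreal (infdist x A))) (\<lambda>x. ennreal (1 / infdist x A))) E"
      by (simp add: emeasure_density)
    also have "\<dots> = emeasure \<mu> E"
      using \<open>- A \<inter> E = E\<close>
      by (simp add: density_infdist_inverse emeasure_density flip: indicator_inter_arith)
    finally show "emeasure \<nu> E \<le> emeasure \<mu> E" .
  qed
  show ?thesis
  proof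
    show "rel_class A \<nu> \<in> M1_plus A" using rep' by (simp add: M1_plus_eq)
    show "ennreal (weight A (rel_class A \<nu>) E) = emeasure F E" if "E \<in> sets borel" for E
      using ennreal_weight[OF rep' that] by (simp add: dens)
  qed
qed

section \<open>Order structure of the positive cone\<close>

text \<open>A finitely additive set function squeezed between 0 and a finite measure is continuous
  at the empty set, hence countably additive; \<open>M1_plus_dominated\<close> then realises it as a
  weight.\<close>

lemma M1_plus_additive:
  assumes M: "M \<in> M1_plus A"
    and bounds: "\<And>E. E \<in> sets borel \<Longrightarrow> 0 \<le> g E" "\<And>E. E \<in> sets borel \<Longrightarrow> g E \<le> weight A M E"
    and add: "\<And>E F. E \<in> sets borel \<Longrightarrow> F \<in> sets borel \<Longrightarrow> E \<inter> F = {} \<Longrightarrow> g (E \<union> F) = g E + g F"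
  obtains L where "L \<in> M1_plus A" "\<And>E. E \<in> sets borel \<Longrightarrow> weight A L E = g E"
proof -
  obtain \<mu> where rep: "\<mu> \<in> representatives A" and M_eq: "M = rel_class A \<mu>"
    using M by (auto simp: M1_plus_eq)
  define F where "F = measure_of UNIV (sets borel) (\<lambda>E. ennreal (g E))"
  have positive: "positive (sets borel) (\<lambda>E. ennreal (g E))"
    \<comment> \<open>Additivity for two empty sets forces \<open>g {} = 0\<close>.\<close>
    using add[of "{}" "{}"] by (simp add: positive_def)
  have countably: "countably_additive (sets borel) (\<lambda>E. ennreal (g E))"
  proof (rule sets.empty_continuous_imp_countably_additive[OF positive])
    show "additive (sets borel) (\<lambda>E. ennreal (g E))"
      using bounds by (simp add: additive_def add)
    fix B :: "nat \<Rightarrow> 'a set"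
    assume B: "range B \<subseteq> sets borel" "decseq B" "(\<Inter>i. B i) = {}"
    have "(\<lambda>i. emeasure (density \<mu> (\<lambda>x. ennreal (infdist x A))) (B i)) \<longlonglongrightarrow>
        emeasure (density \<mu> (\<lambda>x. ennreal (infdist x A))) (\<Inter>i. B i)"
    proof (rule Lim_emeasure_decseq)
      fix i
      have "emeasure (density \<mu> (\<lambda>x. ennreal (infdist x A))) (B i) = ennreal (weight A M (B i))"
        using B by (subst M_eq, subst ennreal_weight[OF rep]) auto
      then show "emeasure (density \<mu> (\<lambda>x. ennreal (infdist x A))) (B i) \<noteq> \<infinity>" by simp
    qed (use B sets_representative[OF rep] in auto)
    moreover have "emeasure (density \<mu> (\<lambda>x. ennreal (infdist x A))) (B i) = ennreal (weight A M (B i))" for i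
      using B by (subst M_eq, subst ennreal_weight[OF rep]) auto
    ultimately have lim: "(\<lambda>i. ennreal (weight A M (B i))) \<longlonglongrightarrow> 0" by (simp add: B)
    show "(\<lambda>i. ennreal (g (B i))) \<longlonglongrightarrow> 0"
    proof (rule tendsto_sandwich[OF _ _ tendsto_const lim])
      show "\<forall>\<^sub>F i in sequentially. ennreal (g (B i)) \<le> ennreal (weight A M (B i))"
        using B by (intro always_eventually allI ennreal_leI bounds) auto
    qed simp
  qed simp
  have sets_F: "sets F = sets borel"
    using sets.sigma_sets_eq[of "borel :: 'a measure"] by (simp add: F_def)
  have F: "emeasure F E = ennreal (g E)" if "E \<in> sets borel" for E
    unfolding F_def using positive countably that sets.sigma_algebra_axioms[of "borel :: 'a measure"]
    by (intro emeasure_measure_of_sigma) auto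
  obtain L where "L \<in> M1_plus A" "\<And>E. E \<in> sets borel \<Longrightarrow> ennreal (weight A L E) = emeasure F E"
    using M1_plus_dominated[OF M sets_F] F bounds by (metis ennreal_leI)
  moreover from this have "weight A L E = g E" if "E \<in> sets borel" for E
    using that F bounds by (simp add: weight_nonneg)
  ultimately show ?thesis using that by blast
qed

lemma weight_Un:
  assumes "M \<in> M1_plus A" "E \<in> sets borel" "F \<in> sets borel" "E \<inter> F = {}"
  shows "weight A M (E \<union> F) = weight A M E + weight A M F"
proof -
  have "(\<lambda>x. indicator (E \<union> F) x * infdist x A) =
      (\<lambda>x. indicator E x * infdist x A + indicator F x * infdist x A)"
    using assms(4) by (auto simp: fun_eq_iff indicator_def)
  then show ?thesis
    using assms by (simp add: weight_def rel_integral_add dist_dominated_weight)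
qed

lemma weight_add:
  assumes "M \<in> M1_plus A" "N \<in> M1_plus A" "E \<in> sets borel"
  shows "weight A (rel_add A M N) E = weight A M E + weight A N E"
  using assms by (simp add: weight_def M1_plus_add dist_dominated_weight)

text \<open>Subtraction in the cone. The difference of the two weights is additive and lies between
  0 and the weight of \<open>M\<close>, so it is a weight; \<open>M1_plus_eqI\<close> then
  identifies the sum.\<close>

lemma M1_plus_diff:
  assumes M: "M \<in> M1_plus A" and N: "N \<in> M1_plus A"
    and le: "\<And>E. E \<in> sets borel \<Longrightarrow> weight A N E \<le> weight A M E"
  obtains L where "L \<in> M1_plus A" "M = rel_add A N L"
proof -
  obtain L where L: "L \<in> M1_plus A"
    and weight: "\<And>E. E \<in> sets borel \<Longrightarrow> weight A L E = weight A M E - weight A N E"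
    by (rule M1_plus_additive[OF M, of "\<lambda>E. weight A M E - weight A N E"])
      (use le weight_nonneg[OF N] in \<open>auto simp: weight_Un[OF M] weight_Un[OF N]\<close>)
  have "M = rel_add A N L"
    by (intro M1_plus_eqI M M1_plus_add N L) (simp add: weight weight_add N L)
  then show ?thesis using L that by blast
qed

text \<open>Only directedness matters: it makes the setwise infimum of the measures additive, and
  domination by a single finite measure makes it countably additive.\<close>

lemma M1_plus_directed_Inf:
  assumes D: "D \<noteq> {}" and M: "\<And>i. i \<in> D \<Longrightarrow> M i \<in> M1_plus A"
    and directed: "\<And>i j. i \<in> D \<Longrightarrow> j \<in> D \<Longrightarrow>
      \<exists>k\<in>D. \<forall>E\<in>sets borel. weight A (M k) E \<le> weight A (M i) E \<and> weight A (M k) E \<le> weight A (M j) E"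
  obtains L where "L \<in> M1_plus A" "\<And>E. E \<in> sets borel \<Longrightarrow> weight A L E = (INF i\<in>D. weight A (M i) E)"
proof -
  define g where "g E = (INF i\<in>D. weight A (M i) E)" for E
  have bdd: "bdd_below ((\<lambda>i. weight A (M i) E) ` D)" if "E \<in> sets borel" for E
    using weight_nonneg[OF M that] by (auto intro!: bdd_belowI[of _ 0])
  have lower: "g E \<le> weight A (M i) E" if "E \<in> sets borel" "i \<in> D" for E i
    unfolding g_def using bdd that by (intro cINF_lower)
  have greatest: "c \<le> g E" if "\<And>i. i \<in> D \<Longrightarrow> c \<le> weight A (M i) E" for c E
    unfolding g_def using D that by (intro cINF_greatest)
  obtain i where i: "i \<in> D" using D by auto
  obtain L where L: "L \<in> M1_plus A" "\<And>E. E \<in> sets borel \<Longrightarrow> weight A L E = g E"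
  proof (rule M1_plus_additive[OF M[OF i], of g])
    show "0 \<le> g E" if "E \<in> sets borel" for E
      using that by (intro greatest weight_nonneg M)
    show "g E \<le> weight A (M i) E" if "E \<in> sets borel" for E
      using that i by (rule lower)
    fix E F :: "'a set" assume EF: "E \<in> sets borel" "F \<in> sets borel" "E \<inter> F = {}"
    show "g (E \<union> F) = g E + g F"
    proof (rule antisym)
      show "g E + g F \<le> g (E \<union> F)"
        using EF by (intro greatest) (simp add: weight_Un M add_mono lower)
      \<comment> \<open>\<open>E\<close> and \<open>F\<close> may be nearly minimised at different
        indices; one index below both bounds the two terms simultaneously. The infima over
        \<open>i\<close> and over \<open>j\<close> are then taken one after the other.\<close>
      have "g (E \<union> F) \<le> weight A (M i) E + weight A (M j) F" if ij: "i \<in> D" "j \<in> D" for i j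
      proof -
        obtain k where "k \<in> D" "weight A (M k) E \<le> weight A (M i) E" "weight A (M k) F \<le> weight A (M j) F"
          using directed[OF ij] EF by blast
        moreover have "g (E \<union> F) \<le> weight A (M k) E + weight A (M k) F"
          using EF \<open>k \<in> D\<close> lower[of "E \<union> F" k] by (simp add: weight_Un M)
        ultimately show ?thesis by linarith
      qed
      then have "g (E \<union> F) - weight A (M j) F \<le> g E" if "j \<in> D" for j
        using that by (intro greatest) (simp add: algebra_simps)
      then have "g (E \<union> F) - g E \<le> g F"
        by (intro greatest) (simp add: algebra_simps)
      then show "g (E \<union> F) \<le> g E + g F" by simp
    qed
  qed blast
  then show ?thesis using that unfolding g_def by blast
qed

text \<open>Supplies the pieces when a positive measure is cut along a Borel set. The restriction
  lies below the original measure, so \<open>representatives_mono\<close> gives tightness.\<close>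

lemma M1_plus_restrict:
  assumes M: "M \<in> M1_plus A" and B [measurable]: "B \<in> sets borel"
  obtains L where "L \<in> M1_plus A"
    "\<And>f. f \<in> dist_dominated A \<Longrightarrow> rel_integral L f = rel_integral M (\<lambda>x. indicator B x * f x)"
proof -
  obtain \<mu> where rep: "\<mu> \<in> representatives A" and M_eq: "M = rel_class A \<mu>"
    using M by (auto simp: M1_plus_eq)
  note sets [simp, measurable_cong] = sets_representative[OF rep]
  define \<nu> where "\<nu> = density \<mu> (\<lambda>x. ennreal (indicator B x))"
  have rep': "\<nu> \<in> representatives A"
  proof (rule representatives_mono[OF rep])
    show "sets \<nu> = sets borel" by (simp add: \<nu>_def)
    show "emeasure \<nu> E \<le> emeasure \<mu> E" if [measurable]: "E \<in> sets borel" for E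
    proof -
      have "emeasure \<nu> E = emeasure \<mu> (B \<inter> E)"
        by (simp add: \<nu>_def emeasure_density ennreal_indicator flip: indicator_inter_arith)
      then show ?thesis by (simp add: emeasure_mono)
    qed
    have "(\<integral>\<^sup>+x. ennreal (infdist x A) \<partial>\<nu>) = (\<integral>\<^sup>+x. ennreal (indicator B x) * ennreal (infdist x A) \<partial>\<mu>)"
      unfolding \<nu>_def by (rule nn_integral_density) auto
    also have "\<dots> \<le> (\<integral>\<^sup>+x. ennreal (infdist x A) \<partial>\<mu>)"
      by (intro nn_integral_mono) (auto split: split_indicator)
    also have "\<dots> < \<infinity>" using rep by (simp add: representatives_def)
    finally show "(\<integral>\<^sup>+x. ennreal (infdist x A) \<partial>\<nu>) < \<infinity>" .
  qed
  show ?thesis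
  proof
    show "rel_class A \<nu> \<in> M1_plus A" using rep' by (simp add: M1_plus_eq)
    fix f assume f: "f \<in> dist_dominated A"
    then have [measurable]: "f \<in> borel_measurable borel" by (simp add: dist_dominated_def)
    have "rel_integral (rel_class A \<nu>) f = (\<integral>x. f x \<partial>\<nu>)"
      using rep' f by (simp add: rel_integral_rel_class sets_representative)
    also have "\<dots> = (\<integral>x. indicator B x *\<^sub>R f x \<partial>\<mu>)"
      unfolding \<nu>_def by (rule integral_density) auto
    also have "\<dots> = rel_integral M (\<lambda>x. indicator B x * f x)"
      using f by (simp add: M_eq rel_integral_rel_class dist_dominated_indicator)
    finally show "rel_integral (rel_class A \<nu>) f = rel_integral M (\<lambda>x. indicator B x * f x)" .
  qed
qed

text \<open>A Dirac measure is tight because singletons are compact. The point may lie in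
  \<open>A\<close>; the class is then zero, and so is \<open>f x\<close>.\<close>

lemma M1_plus_dirac:
  obtains L where "L \<in> M1_plus A" "\<And>f. f \<in> dist_dominated A \<Longrightarrow> rel_integral L f = f x"
proof -
  have "return borel x \<in> representatives A"
    unfolding representatives_def
  proof (intro CollectI conjI ballI impI)
    show "(\<integral>\<^sup>+y. ennreal (infdist y A) \<partial>return borel x) < \<infinity>"
      by (subst nn_integral_return) auto
    fix E :: "'a set" assume E: "E \<in> sets borel"
    have "(SUP K\<in>{K. compact K \<and> K \<subseteq> E}. emeasure (return borel x) K) \<le> emeasure (return borel x) E"
      using E by (intro SUP_least emeasure_mono) auto
    moreover have "emeasure (return borel x) E \<le> (SUP K\<in>{K. compact K \<and> K \<subseteq> E}. emeasure (return borel x) K)"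
    proof (cases "x \<in> E")
      case True
      then have "emeasure (return borel x) {x} \<le> (SUP K\<in>{K. compact K \<and> K \<subseteq> E}. emeasure (return borel x) K)"
        by (intro SUP_upper) auto
      then show ?thesis using True E by simp
    qed (use E in simp)
    ultimately show "emeasure (return borel x) E = (SUP K\<in>{K. compact K \<and> K \<subseteq> E}. emeasure (return borel x) K)"
      by (rule antisym[rotated])
  qed simp
  moreover from this have "rel_integral (rel_class A (return borel x)) f = f x"
    if "f \<in> dist_dominated A" for f
    using that by (simp add: rel_integral_rel_class sets_representative dist_dominated_def integral_return)
  ultimately show ?thesis using that by (auto simp: M1_plus_eq)
qed

section \<open>Differences of relative measures\<close>

text \<open>Weights are integrals of dominated functions and determine elements of the cone.
  Equations between formal differences can therefore be tested by integrals, that is, by equations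
  of real numbers.\<close>

lemma in_diff_class_iff:
  assumes MN: "M \<in> M1_plus A" "N \<in> M1_plus A"
  shows "(M', N') \<in> diff_class A M N \<longleftrightarrow> M' \<in> M1_plus A \<and> N' \<in> M1_plus A \<and>
    (\<forall>f\<in>dist_dominated A. rel_integral M f - rel_integral N f = rel_integral M' f - rel_integral N' f)"
    (is "?L \<longleftrightarrow> ?R")
proof
  assume ?L
  then have M'N': "M' \<in> M1_plus A" "N' \<in> M1_plus A" and eq: "rel_add A M N' = rel_add A M' N"
    by (auto simp: diff_class_def diff_equiv_def)
  have "rel_integral M f + rel_integral N' f = rel_integral M' f + rel_integral N f"
    if "f \<in> dist_dominated A" for f
    using M1_plus_add(2)[OF MN(1) M'N'(2) that] M1_plus_add(2)[OF M'N'(1) MN(2) that] eq by simp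
  then show ?R using M'N' by (auto simp: algebra_simps)
next
  assume R: ?R
  then have "rel_add A M N' = rel_add A M' N"
    using MN
  proof (intro M1_plus_eqI M1_plus_add)
    fix E :: "'a set" assume E: "E \<in> sets borel"
    then have "weight A M E - weight A N E = weight A M' E - weight A N' E"
      using R unfolding weight_def by (blast intro: dist_dominated_weight)
    then show "weight A (rel_add A M N') E = weight A (rel_add A M' N) E"
      using R MN E by (simp add: weight_add algebra_simps)
  qed auto
  then show ?L using R MN by (simp add: diff_class_def diff_equiv_def)
qed

lemma diff_class_eqI:
  assumes "M \<in> M1_plus A" "N \<in> M1_plus A" "M' \<in> M1_plus A" "N' \<in> M1_plus A"
    and "\<And>f. f \<in> dist_dominated A \<Longrightarrow>
      rel_integral M f - rel_integral N f = rel_integral M' f - rel_integral N' f"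
  shows "diff_class A M N = diff_class A M' N'"
proof (rule set_eqI)
  fix p show "p \<in> diff_class A M N \<longleftrightarrow> p \<in> diff_class A M' N'"
    using assms by (cases p) (simp add: in_diff_class_iff)
qed

lemma diff_integral_diff_class:
  assumes MN: "M \<in> M1_plus A" "N \<in> M1_plus A" and f: "f \<in> dist_dominated A"
  shows "diff_integral (diff_class A M N) f = rel_integral M f - rel_integral N f"
proof -
  have "(M, N) \<in> diff_class A M N" using MN by (simp add: in_diff_class_iff)
  then have "(\<lambda>(M, N). rel_integral M f - rel_integral N f) ` diff_class A M N =
      {rel_integral M f - rel_integral N f}"
    using MN f by (fastforce simp: in_diff_class_iff)
  then show ?thesis by (simp add: diff_integral_def)
qed

lemma M1_cases:
  assumes "x \<in> carr (M1 A)"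
  obtains M N where "M \<in> M1_plus A" "N \<in> M1_plus A" "x = diff_class A M N"
  using assms by (auto simp: M1_def quotient_def diff_class_def)

lemma diff_class_carrier:
  "M \<in> M1_plus A \<Longrightarrow> N \<in> M1_plus A \<Longrightarrow> diff_class A M N \<in> carr (M1 A)"
  by (auto simp: M1_def diff_class_def intro!: quotientI)

lemma diff_add_diff_class:
  assumes "M \<in> M1_plus A" "N \<in> M1_plus A" "M' \<in> M1_plus A" "N' \<in> M1_plus A"
  shows "diff_add A (diff_class A M N) (diff_class A M' N') = diff_class A (rel_add A M M') (rel_add A N N')"
proof -
  \<comment> \<open>Independence of the chosen pairs: integrals of sums are sums of integrals, so
    equal differences add up to equal differences. The unions in \<open>diff_add\<close> thus have a
    single constant term.\<close>
  have const: "diff_class A (rel_add A P P') (rel_add A Q Q') = diff_class A (rel_add A M M') (rel_add A N N')"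
    if P: "(P, Q) \<in> diff_class A M N" and P': "(P', Q') \<in> diff_class A M' N'" for P Q P' Q'
  proof -
    note eqs = P[unfolded in_diff_class_iff[OF assms(1,2)]] P'[unfolded in_diff_class_iff[OF assms(3,4)]]
    show ?thesis
    proof (intro diff_class_eqI M1_plus_add)
      show mem: "P \<in> M1_plus A" "P' \<in> M1_plus A" "Q \<in> M1_plus A" "Q' \<in> M1_plus A"
        using eqs by auto
      fix f assume f: "f \<in> dist_dominated A"
      have "rel_integral M f - rel_integral N f = rel_integral P f - rel_integral Q f"
        "rel_integral M' f - rel_integral N' f = rel_integral P' f - rel_integral Q' f"
        using eqs f by auto
      then show "rel_integral (rel_add A P P') f - rel_integral (rel_add A Q Q') f =
          rel_integral (rel_add A M M') f - rel_integral (rel_add A N N') f"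
        unfolding M1_plus_add(2)[OF mem(1,2) f] M1_plus_add(2)[OF mem(3,4) f]
          M1_plus_add(2)[OF assms(1,3) f] M1_plus_add(2)[OF assms(2,4) f] by linarith
    qed (use assms in auto)
  qed
  have "diff_add A (diff_class A M N) (diff_class A M' N') =
      (\<Union>(P, Q)\<in>diff_class A M N. \<Union>(P', Q')\<in>diff_class A M' N'.
        diff_class A (rel_add A P P') (rel_add A Q Q'))"
    by (simp add: diff_add_def diff_class_def)
  also have "\<dots> = (\<Union>p\<in>diff_class A M N. \<Union>q\<in>diff_class A M' N'.
        diff_class A (rel_add A M M') (rel_add A N N'))"
    unfolding case_prod_beta by (intro SUP_cong refl const) auto
  also have "\<dots> = diff_class A (rel_add A M M') (rel_add A N N')"
  proof -
    have "diff_class A M N \<noteq> {}" "diff_class A M' N' \<noteq> {}"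
      using in_diff_class_iff[OF assms(1,2), of M N] in_diff_class_iff[OF assms(3,4), of M' N'] assms by auto
    then show ?thesis by (simp only: UN_constant if_False)
  qed
  finally show ?thesis .
qed

text \<open>A negative scalar exchanges the two components, so that the cone is only ever scaled by
  nonnegative numbers. As for sums, equal integrals make all terms of the union coincide.\<close>

lemma diff_scale_diff_class:
  assumes "M \<in> M1_plus A" "N \<in> M1_plus A"
  shows "diff_scale A c (diff_class A M N) =
    (if c \<ge> 0 then diff_class A (rel_scale A c M) (rel_scale A c N)
     else diff_class A (rel_scale A (- c) N) (rel_scale A (- c) M))"
proof -
  let ?g = "\<lambda>M N. if c \<ge> 0 then diff_class A (rel_scale A c M) (rel_scale A c N)
     else diff_class A (rel_scale A (- c) N) (rel_scale A (- c) M)"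
  have const: "?g P Q = ?g M N" if P: "(P, Q) \<in> diff_class A M N" for P Q
  proof -
    note eqs = P[unfolded in_diff_class_iff[OF assms]]
    have eq: "c * rel_integral M f - c * rel_integral N f = c * rel_integral P f - c * rel_integral Q f"
      if "f \<in> dist_dominated A" for f
      using eqs that by (simp flip: right_diff_distrib)
    show ?thesis
    proof (cases "c \<ge> 0")
      case True
      then have "diff_class A (rel_scale A c P) (rel_scale A c Q) =
          diff_class A (rel_scale A c M) (rel_scale A c N)"
        using eqs assms eq by (intro diff_class_eqI) (auto simp: M1_plus_scale)
      then show ?thesis using True by simp
    next
      case False
      then have "diff_class A (rel_scale A (- c) Q) (rel_scale A (- c) P) =
          diff_class A (rel_scale A (- c) N) (rel_scale A (- c) M)"
        using eqs assms eq by (intro diff_class_eqI) (auto simp: M1_plus_scale algebra_simps)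
      then show ?thesis using False by simp
    qed
  qed
  have "diff_scale A c (diff_class A M N) = (\<Union>(P, Q)\<in>diff_class A M N. ?g P Q)"
    unfolding diff_scale_def diff_class_def by (intro SUP_cong) auto
  also have "\<dots> = (\<Union>p\<in>diff_class A M N. ?g M N)"
    by (intro SUP_cong refl) (use const in \<open>auto split del: if_split\<close>)
  also have "\<dots> = ?g M N"
  proof -
    have "diff_class A M N \<noteq> {}"
      using in_diff_class_iff[OF assms, of M N] assms by auto
    then show ?thesis by (simp only: UN_constant if_False)
  qed
  finally show ?thesis .
qed

section \<open>Integration against differences\<close>

lemma M1_add:
  assumes "x \<in> carr (M1 A)" "y \<in> carr (M1 A)"
  shows "diff_add A x y \<in> carr (M1 A)"
    and "f \<in> dist_dominated A \<Longrightarrow> diff_integral (diff_add A x y) f = diff_integral x f + diff_integral y f"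
proof -
  obtain M N M' N' where "M \<in> M1_plus A" "N \<in> M1_plus A" "M' \<in> M1_plus A" "N' \<in> M1_plus A"
    "x = diff_class A M N" "y = diff_class A M' N'"
    using assms by (metis M1_cases)
  then show "diff_add A x y \<in> carr (M1 A)"
    and "f \<in> dist_dominated A \<Longrightarrow> diff_integral (diff_add A x y) f = diff_integral x f + diff_integral y f"
    by (simp_all add: diff_add_diff_class diff_class_carrier diff_integral_diff_class M1_plus_add)
qed

lemma M1_scale:
  assumes "x \<in> carr (M1 A)"
  shows "diff_scale A c x \<in> carr (M1 A)"
    and "f \<in> dist_dominated A \<Longrightarrow> diff_integral (diff_scale A c x) f = c * diff_integral x f"
proof -
  obtain M N where "M \<in> M1_plus A" "N \<in> M1_plus A" "x = diff_class A M N"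
    using assms by (rule M1_cases)
  then show "diff_scale A c x \<in> carr (M1 A)"
    and "f \<in> dist_dominated A \<Longrightarrow> diff_integral (diff_scale A c x) f = c * diff_integral x f"
    by (simp_all add: diff_scale_diff_class diff_class_carrier diff_integral_diff_class
        M1_plus_scale algebra_simps)
qed

lemma diff_of_eq: "diff_of A M = diff_class A M (rel_zero A)"
  by (simp add: diff_of_def diff_class_def)

lemma M1_diff_of:
  assumes "M \<in> M1_plus A"
  shows "diff_of A M \<in> carr (M1 A)"
    and "f \<in> dist_dominated A \<Longrightarrow> diff_integral (diff_of A M) f = rel_integral M f"
  using assms by (auto simp: diff_of_eq diff_class_carrier diff_integral_diff_class M1_plus_zero)

text \<open>Integrals of dominated functions separate the differences; this reduces the vector space
  identities used later to arithmetic.\<close>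

lemma M1_eqI:
  assumes "x \<in> carr (M1 A)" "y \<in> carr (M1 A)"
    and eq: "\<And>f. f \<in> dist_dominated A \<Longrightarrow> diff_integral x f = diff_integral y f"
  shows "x = y"
proof -
  obtain M N M' N' where MN: "M \<in> M1_plus A" "N \<in> M1_plus A" "M' \<in> M1_plus A" "N' \<in> M1_plus A"
    and xy: "x = diff_class A M N" "y = diff_class A M' N'"
    using assms by (metis M1_cases)
  show ?thesis
    unfolding xy using eq MN by (intro diff_class_eqI) (auto simp: xy diff_integral_diff_class)
qed

lemma diff_integral_add:
  assumes "x \<in> carr (M1 A)" "f \<in> dist_dominated A" "g \<in> dist_dominated A"
  shows "diff_integral x (\<lambda>t. f t + g t) = diff_integral x f + diff_integral x g"
  using assms(1)
  by (rule M1_cases) (simp add: assms(2,3) diff_integral_diff_class rel_integral_add dist_dominated_add)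

lemma diff_integral_cmult:
  assumes "x \<in> carr (M1 A)" "f \<in> dist_dominated A"
  shows "diff_integral x (\<lambda>t. c * f t) = c * diff_integral x f"
  using assms(1)
  by (rule M1_cases)
    (simp add: assms(2) diff_integral_diff_class rel_integral_cmult dist_dominated_cmult algebra_simps)

section \<open>The order on differences\<close>

lemma vleq_M1_iff: "vleq (M1 A) x y \<longleftrightarrow> (\<exists>M\<in>M1_plus A. y = diff_add A x (diff_of A M))"
  by (simp add: M1_def)

lemma vleq_M1_mono:
  assumes "x \<in> carr (M1 A)" "vleq (M1 A) x y" "f \<in> dist_dominated A" "\<And>t. 0 \<le> f t"
  shows "diff_integral x f \<le> diff_integral y f"
  using assms by (auto simp: vleq_M1_iff M1_add M1_diff_of rel_integral_nonneg)

text \<open>Weighted indicators suffice to detect the order. For \<open>x = M - N\<close> and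
  \<open>y = M' - N'\<close> the hypothesis compares the weights of \<open>M + N'\<close> and
  \<open>M' + N\<close>; their difference \<open>L\<close>, from \<open>M1_plus_diff\<close>,
  witnesses the inequality.\<close>

lemma vleq_M1I:
  assumes "x \<in> carr (M1 A)" "y \<in> carr (M1 A)"
    and le: "\<And>E. E \<in> sets borel \<Longrightarrow>
      diff_integral x (\<lambda>t. indicator E t * infdist t A) \<le> diff_integral y (\<lambda>t. indicator E t * infdist t A)"
  shows "vleq (M1 A) x y"
proof -
  obtain M N M' N' where MN: "M \<in> M1_plus A" "N \<in> M1_plus A" "M' \<in> M1_plus A" "N' \<in> M1_plus A"
    and xy: "x = diff_class A M N" "y = diff_class A M' N'"
    using assms by (metis M1_cases)
  have "weight A (rel_add A M N') E \<le> weight A (rel_add A M' N) E" if E: "E \<in> sets borel" for E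
  proof -
    have "weight A M E - weight A N E \<le> weight A M' E - weight A N' E"
      using le[OF E] MN E by (simp add: xy diff_integral_diff_class dist_dominated_weight weight_def)
    then show ?thesis using MN E by (simp add: weight_add)
  qed
  then obtain L where L: "L \<in> M1_plus A" and eq: "rel_add A M' N = rel_add A (rel_add A M N') L"
    using M1_plus_diff[of "rel_add A M' N" "rel_add A M N'"] MN M1_plus_add(1) by metis
  have "y = diff_add A x (diff_of A L)"
  proof (intro M1_eqI M1_add assms M1_diff_of L)
    fix f assume f: "f \<in> dist_dominated A"
    have "rel_integral M' f + rel_integral N f = rel_integral M f + rel_integral N' f + rel_integral L f"
      using arg_cong[OF eq, of "\<lambda>P. rel_integral P f"] MN L f by (simp add: M1_plus_add)
    then show "diff_integral y f = diff_integral (diff_add A x (diff_of A L)) f"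
      using assms(1,2) MN L f by (simp add: M1_add M1_diff_of) (simp add: xy diff_integral_diff_class)
  qed
  then show ?thesis using L by (auto simp: vleq_M1_iff)
qed

lemma M1_zero:
  shows "vzero (M1 A) \<in> carr (M1 A)"
    and "f \<in> dist_dominated A \<Longrightarrow> diff_integral (vzero (M1 A)) f = 0"
proof -
  have zero: "vzero (M1 A) = diff_of A (rel_zero A)" by (simp add: M1_def)
  show "vzero (M1 A) \<in> carr (M1 A)"
    unfolding zero by (intro M1_diff_of M1_plus_zero)
  show "diff_integral (vzero (M1 A)) f = 0" if "f \<in> dist_dominated A"
    unfolding zero using that by (simp add: M1_diff_of M1_plus_zero)
qed

lemma M1_nonneg_iff: "vleq (M1 A) (vzero (M1 A)) x \<longleftrightarrow> (\<exists>M\<in>M1_plus A. x = diff_of A M)"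
proof -
  have "diff_add A (vzero (M1 A)) (diff_of A M) = diff_of A M" if "M \<in> M1_plus A" for M
    using that by (intro M1_eqI) (auto simp: M1_add M1_diff_of M1_zero)
  then show ?thesis by (auto simp: vleq_M1_iff)
qed

section \<open>Functionals given by dominated functions\<close>

text \<open>The two inequalities say that \<open>y - x\<close> and \<open>y + x\<close> are
  positive. Testing them on the nonnegative functions \<open>C * infdist t A + g t\<close> and
  \<open>C * infdist t A - g t\<close> and adding gives twice the bound. With two inequalities in
  place of an absolute value, no supremum in \<open>M1 A\<close> has to be formed.\<close>

lemma abs_diff_integral_le:
  assumes x: "x \<in> carr (M1 A)" and y: "y \<in> carr (M1 A)"
    and le: "vleq (M1 A) x y" "vleq (M1 A) (diff_scale A (-1) x) y"
    and f: "f \<in> dist_dominated A" and bound: "\<And>t. \<bar>f t\<bar> \<le> C * infdist t A"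
  shows "\<bar>diff_integral x f\<bar> \<le> C * diff_integral y (\<lambda>t. infdist t A)"
proof -
  have *: "diff_integral x g \<le> C * diff_integral y (\<lambda>t. infdist t A)"
    if g: "g \<in> dist_dominated A" and bound: "\<And>t. \<bar>g t\<bar> \<le> C * infdist t A" for g
  proof -
    note dom = dist_dominated_infdist[of A] g dist_dominated_cmult[OF g, of "-1"]
      dist_dominated_cmult[OF dist_dominated_infdist[of A], of C]
    note dom_add = dist_dominated_add[OF dom(4,2)] dist_dominated_add[OF dom(4,3)]
    have pos: "0 \<le> C * infdist t A + g t" "0 \<le> C * infdist t A + (-1) * g t" for t
      using bound[of t] by (auto simp: abs_le_iff)
    have "diff_integral x (\<lambda>t. C * infdist t A + g t) \<le> diff_integral y (\<lambda>t. C * infdist t A + g t)"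
      by (rule vleq_M1_mono[OF x le(1) dom_add(1) pos(1)])
    moreover have "diff_integral (diff_scale A (-1) x) (\<lambda>t. C * infdist t A + (-1) * g t) \<le>
        diff_integral y (\<lambda>t. C * infdist t A + (-1) * g t)"
      by (rule vleq_M1_mono[OF M1_scale(1)[OF x] le(2) dom_add(2) pos(2)])
    moreover have "diff_integral w (\<lambda>t. C * infdist t A + g t) =
          C * diff_integral w (\<lambda>t. infdist t A) + diff_integral w g"
        "diff_integral w (\<lambda>t. C * infdist t A + (-1) * g t) =
          C * diff_integral w (\<lambda>t. infdist t A) - diff_integral w g" if "w \<in> carr (M1 A)" for w
      using diff_integral_add[OF that dom(4,2)] diff_integral_add[OF that dom(4,3)]
        diff_integral_cmult[OF that dom(1), of C] diff_integral_cmult[OF that dom(2), of "-1"]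
      by simp_all
    ultimately show ?thesis
      using x y by (simp add: M1_scale(2)[OF x dom_add(2), simplified])
  qed
  \<comment> \<open>The one-sided estimate for \<open>- f\<close> gives the other half of the
    absolute value.\<close>
  have "diff_integral x (\<lambda>t. (-1) * f t) \<le> C * diff_integral y (\<lambda>t. infdist t A)"
    using bound by (intro * dist_dominated_cmult f) simp
  moreover have "diff_integral x (\<lambda>t. (-1) * f t) = - diff_integral x f"
    using diff_integral_cmult[OF x f, of "-1"] by simp
  ultimately show ?thesis using *[OF f bound] by (simp add: abs_le_iff)
qed

lemma vplus_M1: "vplus (M1 A) = diff_add A" and vscale_M1: "vscale (M1 A) = diff_scale A"
  by (simp_all add: M1_def)

lemma hat_apply: "x \<in> carr (M1 A) \<Longrightarrow> hat A f x = diff_integral x f"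
  by (simp add: hat_def)

lemma hat_linear_functional:
  "f \<in> dist_dominated A \<Longrightarrow> linear_functional (M1 A) (hat A f)"
  by (simp add: linear_functional_def hat_apply vplus_M1 vscale_M1 M1_add M1_scale)

text \<open>Translation by \<open>- a\<close> moves the interval from \<open>a\<close> to
  \<open>b\<close> into the one from 0 to \<open>b - a\<close>, where
  \<open>abs_diff_integral_le\<close> bounds the integral uniformly.\<close>

lemma hat_order_bounded:
  assumes f: "f \<in> dist_dominated A"
  shows "order_bounded (M1 A) (hat A f)"
  unfolding order_bounded_def
proof (intro ballI)
  fix a b assume a: "a \<in> carr (M1 A)" and b: "b \<in> carr (M1 A)"
  obtain C where C: "\<And>t. \<bar>f t\<bar> \<le> C * infdist t A" using f by (auto simp: dist_dominated_def)
  let ?d = "\<lambda>t. infdist t A"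
  define d where "d = diff_add A b (diff_scale A (-1) a)"
  have d: "d \<in> carr (M1 A)" using a b by (simp add: d_def M1_add M1_scale)
  have "\<bar>hat A f x\<bar> \<le> \<bar>diff_integral a f\<bar> + C * diff_integral d ?d"
    if x: "x \<in> carr (M1 A)" "vleq (M1 A) a x" "vleq (M1 A) x b" for x
  proof -
    define z where "z = diff_add A x (diff_scale A (-1) a)"
    have z: "z \<in> carr (M1 A)" using a x by (simp add: z_def M1_add M1_scale)
    have mono: "diff_integral a g \<le> diff_integral x g" "diff_integral x g \<le> diff_integral b g"
      if "g \<in> dist_dominated A" "\<And>t. 0 \<le> g t" for g
      using vleq_M1_mono[OF a x(2) that] vleq_M1_mono[OF x(1,3) that] .
    have J: "diff_integral z g = diff_integral x g - diff_integral a g"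
      "diff_integral d g = diff_integral b g - diff_integral a g" if "g \<in> dist_dominated A" for g
      using that a b x by (auto simp: z_def d_def M1_add M1_scale)
    have "vleq (M1 A) z d" "vleq (M1 A) (diff_scale A (-1) z) d"
    proof -
      show "vleq (M1 A) z d"
        by (intro vleq_M1I z d) (simp add: J dist_dominated_weight mono infdist_nonneg)
      show "vleq (M1 A) (diff_scale A (-1) z) d"
      proof (intro vleq_M1I M1_scale z d)
        fix E :: "'a set" assume "E \<in> sets borel"
        then have "(\<lambda>t. indicator E t * infdist t A) \<in> dist_dominated A"
          by (rule dist_dominated_weight)
        from mono[OF this] J[OF this] M1_scale(2)[OF z this]
        show "diff_integral (diff_scale A (-1) z) (\<lambda>t. indicator E t * infdist t A)
            \<le> diff_integral d (\<lambda>t. indicator E t * infdist t A)"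
          by (simp add: infdist_nonneg)
      qed
    qed
    from abs_diff_integral_le[OF z d this f C]
    have "\<bar>diff_integral x f - diff_integral a f\<bar> \<le> C * diff_integral d ?d"
      using J(1)[OF f] by simp
    then show ?thesis using x by (simp add: hat_apply)
  qed
  then show "bounded (hat A f ` {x \<in> carr (M1 A). vleq (M1 A) a x \<and> vleq (M1 A) x b})"
    unfolding bounded_iff by (intro exI[of _ "\<bar>diff_integral a f\<bar> + C * diff_integral d ?d"]) auto
qed

text \<open>The members of the net are positive, so they come from the cone and have a setwise
  infimum \<open>L\<close>. It is a lower bound of the net, hence at most 0, while its total weight
  is the infimum of the integrals that \<open>u\<close> bounds from below.\<close>

lemma M1_directed_Inf_zero:
  assumes D: "directed_preorder D r" and y: "y ` D \<subseteq> carr (M1 A)"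
    and dec: "\<And>i j. i \<in> D \<Longrightarrow> j \<in> D \<Longrightarrow> r i j \<Longrightarrow> vleq (M1 A) (y j) (y i)"
    and inf: "is_inf (M1 A) (y ` D) (vzero (M1 A))"
    and u: "\<And>i. i \<in> D \<Longrightarrow> u \<le> diff_integral (y i) (\<lambda>t. infdist t A)"
  shows "u \<le> 0"
proof -
  have "\<exists>M. M \<in> M1_plus A \<and> y i = diff_of A M" if "i \<in> D" for i
    using inf that by (auto simp: is_inf_def M1_nonneg_iff)
  then obtain M where M: "\<And>i. i \<in> D \<Longrightarrow> M i \<in> M1_plus A" and yM: "\<And>i. i \<in> D \<Longrightarrow> y i = diff_of A (M i)"
    by metis
  have integral_y: "diff_integral (y i) (\<lambda>t. indicator E t * infdist t A) = weight A (M i) E"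
    if "i \<in> D" "E \<in> sets borel" for i E
    using that M by (simp add: yM M1_diff_of dist_dominated_weight weight_def)
  have nonempty: "D \<noteq> {}" using D by (simp add: directed_preorder_def)
  have "\<exists>k\<in>D. \<forall>E\<in>sets borel. weight A (M k) E \<le> weight A (M i) E \<and> weight A (M k) E \<le> weight A (M j) E"
    if ij: "i \<in> D" "j \<in> D" for i j
  proof -
    obtain k where k: "k \<in> D" "r i k" "r j k"
      using D ij unfolding directed_preorder_def by blast
    have "weight A (M k) E \<le> weight A (M l) E" if "l \<in> D" "r l k" "E \<in> sets borel" for l E
      using vleq_M1_mono[OF _ dec[OF that(1) k(1) that(2)], OF _ dist_dominated_weight[OF that(3)]]
        y k that by (auto simp: integral_y infdist_nonneg)
    then show ?thesis using k ij by blast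
  qed
  from M1_plus_directed_Inf[OF nonempty M this]
  obtain L where L: "L \<in> M1_plus A"
    and weight: "\<And>E. E \<in> sets borel \<Longrightarrow> weight A L E = (INF i\<in>D. weight A (M i) E)"
    by blast
  have bdd: "bdd_below ((\<lambda>i. weight A (M i) E) ` D)" if "E \<in> sets borel" for E
    using weight_nonneg[OF M that] by (auto intro!: bdd_belowI[of _ 0])
  have "vleq (M1 A) (diff_of A L) (y i)" if i: "i \<in> D" for i
  proof (intro vleq_M1I M1_diff_of L)
    show "y i \<in> carr (M1 A)" using y i by auto
    fix E :: "'a set" assume E: "E \<in> sets borel"
    have "weight A L E \<le> weight A (M i) E"
      using weight[OF E] cINF_lower[OF bdd[OF E] i] by simp
    then show "diff_integral (diff_of A L) (\<lambda>t. indicator E t * infdist t A)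
        \<le> diff_integral (y i) (\<lambda>t. indicator E t * infdist t A)"
      using E i L by (simp add: integral_y M1_diff_of dist_dominated_weight weight_def)
  qed
  \<comment> \<open>Here it enters that 0 is the greatest lower bound of the net in
    \<open>M1 A\<close>.\<close>
  then have "vleq (M1 A) (diff_of A L) (vzero (M1 A))"
    using inf M1_diff_of(1)[OF L] unfolding is_inf_def by blast
  from vleq_M1_mono[OF M1_diff_of(1)[OF L] this dist_dominated_weight[of UNIV]]
  have "weight A L UNIV \<le> 0"
    using L by (simp add: infdist_nonneg M1_diff_of M1_zero dist_dominated_infdist weight_def)
  moreover have "u \<le> (INF i\<in>D. weight A (M i) UNIV)"
    using nonempty u by (intro cINF_greatest) (auto simp flip: integral_y)
  ultimately show ?thesis by (simp add: weight)
qed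

text \<open>The images are dominated by a constant multiple of the integrals of
  \<open>infdist t A\<close> against \<open>y i\<close>, a net of reals that decreases to 0 by
  \<open>M1_directed_Inf_zero\<close>.\<close>

lemma hat_order_continuous:
  assumes f: "f \<in> dist_dominated A"
  shows "order_continuous (M1 A) (hat A f)"
  unfolding order_continuous_def
proof (intro allI impI)
  fix D :: "('a rel_diff \<times> 'a rel_diff) set" and r x
  assume D: "directed_preorder D r" and null: "order_null (M1 A) D r x"
  obtain y where x: "x ` D \<subseteq> carr (M1 A)" and y: "y ` D \<subseteq> carr (M1 A)"
    and dec: "\<And>i j. i \<in> D \<Longrightarrow> j \<in> D \<Longrightarrow> r i j \<Longrightarrow> vleq (M1 A) (y j) (y i)"
    and inf: "is_inf (M1 A) (y ` D) (vzero (M1 A))"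
    and dom: "\<And>i. i \<in> D \<Longrightarrow> \<exists>a. is_abs (M1 A) (x i) a \<and> vleq (M1 A) a (y i)"
    using null by (rule order_nullE) blast
  obtain C where C: "\<And>t. \<bar>f t\<bar> \<le> C * infdist t A" using f by (auto simp: dist_dominated_def)
  \<comment> \<open>The constant \<open>C\<close> need not be positive; \<open>c\<close> is, so that
    lower bounds of the net \<open>z\<close> can be divided by it.\<close>
  define c where "c = \<bar>C\<bar> + 1"
  have c: "\<bar>f t\<bar> \<le> c * infdist t A" "0 < c" for t
    using order_trans[OF C mult_right_mono[of C c "infdist t A"]] by (auto simp: c_def infdist_nonneg)
  define z where "z i = c * diff_integral (y i) (\<lambda>t. infdist t A)" for i
  show "order_null real_riesz D r (\<lambda>i. hat A f (x i))"
    unfolding order_null_def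
  proof (intro conjI exI[of _ z] ballI impI)
    show "(\<lambda>i. hat A f (x i)) ` D \<subseteq> carr real_riesz" "z ` D \<subseteq> carr real_riesz"
      by (auto simp: real_riesz_def)
    show "vleq real_riesz (z j) (z i)" if "i \<in> D" "j \<in> D" "r i j" for i j
      using vleq_M1_mono[OF _ dec[OF that] dist_dominated_infdist] y that c(2)
      by (auto simp: real_riesz_def z_def infdist_nonneg)
    show "is_inf real_riesz (z ` D) (vzero real_riesz)"
      unfolding is_inf_def real_riesz_def
    proof (simp, intro conjI ballI allI impI)
      fix i assume i: "i \<in> D"
      then have "vleq (M1 A) (vzero (M1 A)) (y i)" using inf by (auto simp: is_inf_def)
      from vleq_M1_mono[OF M1_zero(1) this dist_dominated_infdist]
      show "0 \<le> z i" using c(2) by (simp add: z_def M1_zero dist_dominated_infdist infdist_nonneg)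
    next
      fix u assume u: "\<forall>i\<in>D. u \<le> z i"
      have "u / c \<le> 0"
        using u c(2) by (intro M1_directed_Inf_zero[OF D y dec inf]) (auto simp: z_def field_simps)
      then show "u \<le> 0" using c(2) by (simp add: divide_le_0_iff)
    qed
    fix i assume i: "i \<in> D"
    obtain a where a: "is_abs (M1 A) (x i) a" "vleq (M1 A) a (y i)" using dom[OF i] by blast
    have carr: "x i \<in> carr (M1 A)" "y i \<in> carr (M1 A)" "a \<in> carr (M1 A)"
      using x y i a by (auto simp: is_abs_def is_sup_def)
    \<comment> \<open>Transitivity of the order, obtained by testing on weighted indicators.\<close>
    have trans: "vleq (M1 A) w (y i)" if "w \<in> carr (M1 A)" "vleq (M1 A) w a" for w
    proof (rule vleq_M1I[OF that(1) carr(2)])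
      fix E :: "'a set" assume "E \<in> sets borel"
      then have dom: "(\<lambda>t. indicator E t * infdist t A) \<in> dist_dominated A"
        by (rule dist_dominated_weight)
      show "diff_integral w (\<lambda>t. indicator E t * infdist t A)
          \<le> diff_integral (y i) (\<lambda>t. indicator E t * infdist t A)"
        using vleq_M1_mono[OF that dom] vleq_M1_mono[OF carr(3) a(2) dom] by (simp add: infdist_nonneg)
    qed
    have "vleq (M1 A) (x i) a" "vleq (M1 A) (diff_scale A (-1) (x i)) a"
      using a(1) by (auto simp: is_abs_def is_sup_def vscale_M1)
    then have "\<bar>hat A f (x i)\<bar> \<le> z i"
      unfolding z_def hat_apply[OF carr(1)]
      by (intro abs_diff_integral_le trans carr M1_scale f c)
    moreover have "is_abs real_riesz (hat A f (x i)) \<bar>hat A f (x i)\<bar>"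
      by (auto simp: is_abs_def is_sup_def real_riesz_def)
    ultimately show "\<exists>a. is_abs real_riesz (hat A f (x i)) a \<and> vleq real_riesz a (z i)"
      by (auto simp: real_riesz_def)
  qed
qed

section \<open>Lattice operations in the order continuous dual\<close>

lemma hat_in_dual:
  assumes "f \<in> dist_dominated A"
  shows "hat A f \<in> carr (order_continuous_dual (M1 A))"
  using assms hat_linear_functional hat_order_bounded hat_order_continuous
  by (simp add: order_continuous_dual_def hat_def)

lemma M1_split:
  assumes x: "vleq (M1 A) (vzero (M1 A)) x" and B: "B \<in> sets borel"
    and fg: "f \<in> dist_dominated A" "g \<in> dist_dominated A"
  obtains x1 x2 where "x1 \<in> carr (M1 A)" "x2 \<in> carr (M1 A)"
    "vleq (M1 A) (vzero (M1 A)) x1" "vleq (M1 A) (vzero (M1 A)) x2" "x = vplus (M1 A) x1 x2"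
    "diff_integral x1 f + diff_integral x2 g = diff_integral x (\<lambda>t. if t \<in> B then f t else g t)"
proof -
  obtain M where M: "M \<in> M1_plus A" and x_eq: "x = diff_of A M"
    using x by (auto simp: M1_nonneg_iff)
  obtain P where P: "P \<in> M1_plus A"
    "\<And>f. f \<in> dist_dominated A \<Longrightarrow> rel_integral P f = rel_integral M (\<lambda>t. indicator B t * f t)"
    using M1_plus_restrict[OF M B] by blast
  obtain Q where Q: "Q \<in> M1_plus A"
    "\<And>f. f \<in> dist_dominated A \<Longrightarrow> rel_integral Q f = rel_integral M (\<lambda>t. indicator (- B) t * f t)"
    using M1_plus_restrict[OF M, of "- B"] B by (auto simp: borel_comp)
  \<comment> \<open>Stated for all pairs of functions: the given pair yields the required formula,
    two equal functions yield the decomposition \<open>x = x1 + x2\<close>.\<close>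
  have sum: "rel_integral P f + rel_integral Q g = rel_integral M (\<lambda>t. if t \<in> B then f t else g t)"
    if "f \<in> dist_dominated A" "g \<in> dist_dominated A" for f g
  proof -
    have "(\<lambda>t. if t \<in> B then f t else g t) = (\<lambda>t. indicator B t * f t + indicator (- B) t * g t)"
      by (auto simp: fun_eq_iff indicator_def)
    then show ?thesis
      using that B M by (simp add: P Q rel_integral_add dist_dominated_indicator borel_comp)
  qed
  show ?thesis
  proof (rule that)
    show "x = vplus (M1 A) (diff_of A P) (diff_of A Q)"
      unfolding vplus_M1
      by (rule M1_eqI) (auto simp: x_eq M P(1) Q(1) M1_diff_of M1_add sum)
    show "vleq (M1 A) (vzero (M1 A)) (diff_of A P)" "vleq (M1 A) (vzero (M1 A)) (diff_of A Q)"
      using P(1) Q(1) by (auto simp: M1_nonneg_iff)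
    have "(\<lambda>t. if t \<in> B then f t else g t) = (\<lambda>t. indicator B t * f t + indicator (- B) t * g t)"
      by (auto simp: fun_eq_iff indicator_def)
    then have "(\<lambda>t. if t \<in> B then f t else g t) \<in> dist_dominated A"
      using fg B by (simp add: dist_dominated_add dist_dominated_indicator borel_comp)
    then show "diff_integral (diff_of A P) f + diff_integral (diff_of A Q) g =
        diff_integral x (\<lambda>t. if t \<in> B then f t else g t)"
      using fg M P(1) Q(1) by (simp add: x_eq M1_diff_of sum)
  qed (use P(1) Q(1) M1_diff_of in auto)
qed

lemma vleq_dual_iff:
  "vleq (order_continuous_dual (M1 A)) S T \<longleftrightarrow>
    (\<forall>x\<in>carr (M1 A). vleq (M1 A) (vzero (M1 A)) x \<longrightarrow> S x \<le> T x)"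
  by (simp add: order_continuous_dual_def)

text \<open>The dual compares functionals on positive elements only. The supremum over
  decompositions of \<open>x\<close> in the Riesz-Kantorovich formula is attained by cutting
  \<open>x\<close> along \<open>{t. g t \<le> f t}\<close>, and the corresponding infimum by cutting
  along \<open>{t. f t \<le> g t}\<close>.\<close>

lemma hat_max_min:
  assumes f: "f \<in> dist_dominated A" and g: "g \<in> dist_dominated A"
    and max: "(\<lambda>t. max (f t) (g t)) \<in> dist_dominated A"
    and min: "(\<lambda>t. min (f t) (g t)) \<in> dist_dominated A"
  shows "is_sup (order_continuous_dual (M1 A)) {hat A f, hat A g} (hat A (\<lambda>t. max (f t) (g t)))"
    and "is_inf (order_continuous_dual (M1 A)) {hat A f, hat A g} (hat A (\<lambda>t. min (f t) (g t)))"
proof -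
  let ?W = "order_continuous_dual (M1 A)"
  have [measurable]: "f \<in> borel_measurable borel" "g \<in> borel_measurable borel"
    using f g by (auto simp: dist_dominated_def)
  have mono: "vleq ?W (hat A h) (hat A k)"
    if hk: "h \<in> dist_dominated A" "k \<in> dist_dominated A" "\<And>t. h t \<le> k t" for h k
    unfolding vleq_dual_iff
  proof (intro ballI impI)
    fix x assume "x \<in> carr (M1 A)" "vleq (M1 A) (vzero (M1 A)) x"
    then obtain M where M: "M \<in> M1_plus A" "x = diff_of A M" "x \<in> carr (M1 A)"
      by (auto simp: M1_nonneg_iff)
    have "0 \<le> rel_integral M (\<lambda>t. k t + (-1) * h t)"
      using hk by (intro rel_integral_nonneg M(1) dist_dominated_add dist_dominated_cmult) simp_all
    then show "hat A h x \<le> hat A k x"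
      using M hk rel_integral_add[OF M(1) hk(2) dist_dominated_cmult[OF hk(1), of "-1"]]
        rel_integral_cmult[OF M(1) hk(1), of "-1"]
      by (simp add: hat_apply M1_diff_of)
  qed
  have T_add: "T (vplus (M1 A) x y) = T x + T y"
    if "T \<in> carr ?W" "x \<in> carr (M1 A)" "y \<in> carr (M1 A)" for T x y
    using that by (auto simp: order_continuous_dual_def linear_functional_def)
  show "is_sup ?W {hat A f, hat A g} (hat A (\<lambda>t. max (f t) (g t)))"
    unfolding is_sup_def
  proof (intro conjI ballI impI)
    show "hat A (\<lambda>t. max (f t) (g t)) \<in> carr ?W" using max by (rule hat_in_dual)
    show "vleq ?W h (hat A (\<lambda>t. max (f t) (g t)))" if "h \<in> {hat A f, hat A g}" for h
      using that f g max by (auto intro!: mono)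
    fix T assume T: "T \<in> carr ?W" and "\<forall>h\<in>{hat A f, hat A g}. vleq ?W h T"
    then have ge: "hat A f x \<le> T x" "hat A g x \<le> T x"
      if "x \<in> carr (M1 A)" "vleq (M1 A) (vzero (M1 A)) x" for x
      using that by (auto simp: vleq_dual_iff)
    show "vleq ?W (hat A (\<lambda>t. max (f t) (g t))) T"
      unfolding vleq_dual_iff
    proof (intro ballI impI)
      fix x assume x: "x \<in> carr (M1 A)" "vleq (M1 A) (vzero (M1 A)) x"
      have B: "{t. g t \<le> f t} \<in> sets borel" by measurable
      obtain x1 x2 where split: "x1 \<in> carr (M1 A)" "x2 \<in> carr (M1 A)"
        "vleq (M1 A) (vzero (M1 A)) x1" "vleq (M1 A) (vzero (M1 A)) x2" "x = vplus (M1 A) x1 x2"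
        "diff_integral x1 f + diff_integral x2 g = diff_integral x (\<lambda>t. if t \<in> {t. g t \<le> f t} then f t else g t)"
        by (rule M1_split[OF x(2) B f g])
      have "(\<lambda>t. if t \<in> {t. g t \<le> f t} then f t else g t) = (\<lambda>t. max (f t) (g t))"
        by (auto simp: fun_eq_iff)
      then have "hat A (\<lambda>t. max (f t) (g t)) x = hat A f x1 + hat A g x2"
        using split(1,2) split(6) x by (simp add: hat_apply)
      also have "\<dots> \<le> T x1 + T x2" using ge split(1-4) by (intro add_mono) auto
      finally show "hat A (\<lambda>t. max (f t) (g t)) x \<le> T x" using T_add[OF T split(1,2)] split(5) by simp
    qed
  qed
  show "is_inf ?W {hat A f, hat A g} (hat A (\<lambda>t. min (f t) (g t)))"
    unfolding is_inf_def
  proof (intro conjI ballI impI)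
    show "hat A (\<lambda>t. min (f t) (g t)) \<in> carr ?W" using min by (rule hat_in_dual)
    show "vleq ?W (hat A (\<lambda>t. min (f t) (g t))) h" if "h \<in> {hat A f, hat A g}" for h
      using that f g min by (auto intro!: mono)
    fix T assume T: "T \<in> carr ?W" and "\<forall>h\<in>{hat A f, hat A g}. vleq ?W T h"
    then have ge: "T x \<le> hat A f x" "T x \<le> hat A g x"
      if "x \<in> carr (M1 A)" "vleq (M1 A) (vzero (M1 A)) x" for x
      using that by (auto simp: vleq_dual_iff)
    show "vleq ?W T (hat A (\<lambda>t. min (f t) (g t)))"
      unfolding vleq_dual_iff
    proof (intro ballI impI)
      fix x assume x: "x \<in> carr (M1 A)" "vleq (M1 A) (vzero (M1 A)) x"
      have B: "{t. f t \<le> g t} \<in> sets borel" by measurable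
      obtain x1 x2 where split: "x1 \<in> carr (M1 A)" "x2 \<in> carr (M1 A)"
        "vleq (M1 A) (vzero (M1 A)) x1" "vleq (M1 A) (vzero (M1 A)) x2" "x = vplus (M1 A) x1 x2"
        "diff_integral x1 f + diff_integral x2 g = diff_integral x (\<lambda>t. if t \<in> {t. f t \<le> g t} then f t else g t)"
        by (rule M1_split[OF x(2) B f g])
      have "(\<lambda>t. if t \<in> {t. f t \<le> g t} then f t else g t) = (\<lambda>t. min (f t) (g t))"
        by (auto simp: fun_eq_iff)
      then have "hat A (\<lambda>t. min (f t) (g t)) x = hat A f x1 + hat A g x2"
        using split(1,2) split(6) x by (simp add: hat_apply)
      moreover have "T x1 + T x2 \<le> hat A f x1 + hat A g x2" using ge split(1-4) by (intro add_mono) auto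
      ultimately show "T x \<le> hat A (\<lambda>t. min (f t) (g t)) x" using T_add[OF T split(1,2)] split(5) by simp
    qed
  qed
qed

section \<open>Lipschitz functions\<close>

text \<open>For \<open>a\<close> in \<open>A\<close> the Lipschitz condition and
  \<open>f a = 0\<close> bound \<open>\<bar>f x\<bar>\<close> by \<open>L * dist x a\<close>; taking
  the infimum over \<open>a\<close> replaces \<open>dist x a\<close> by the distance to
  \<open>A\<close>.\<close>

lemma Lip_dist_dominated:
  assumes "f \<in> carr (Lip A)"
  shows "f \<in> dist_dominated A"
proof -
  obtain L where L: "L-lipschitz_on UNIV f" and zero: "\<And>a. a \<in> A \<Longrightarrow> f a = 0"
    using assms by (auto simp: Lip_def)
  have "\<bar>f x\<bar> \<le> L * infdist x A" for x
  proof -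
    have le: "\<bar>f x\<bar> \<le> L * dist x a" if "a \<in> A" for a
      using lipschitz_onD[OF L, of x a] zero[OF that] by (simp add: dist_real_def)
    show ?thesis
    \<comment> \<open>The infimum is taken after dividing by \<open>L\<close>, so
      \<open>L = 0\<close> is treated separately.\<close>
    proof (cases "L = 0")
      case True
      then show ?thesis using le A_nonempty by auto
    next
      case False
      then have "0 < L" using lipschitz_on_nonneg[OF L] by simp
      then have "\<bar>f x\<bar> / L \<le> infdist x A"
        unfolding infdist_notempty[OF A_nonempty] using le A_nonempty
        by (intro cINF_greatest) (auto simp: field_simps)
      then show ?thesis using \<open>0 < L\<close> by (simp add: field_simps)
    qed
  qed
  moreover have "continuous_on UNIV f" using L by (rule lipschitz_on_continuous_on)
  ultimately show ?thesis
    by (auto simp: dist_dominated_def intro: borel_measurable_continuous_onI)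
qed

lemma Lip_max_min:
  assumes "f \<in> carr (Lip A)" "g \<in> carr (Lip A)"
  shows "(\<lambda>t. max (f t) (g t)) \<in> carr (Lip A)" "(\<lambda>t. min (f t) (g t)) \<in> carr (Lip A)"
proof -
  obtain L K where L: "L-lipschitz_on UNIV f" and K: "K-lipschitz_on UNIV g"
    using assms by (auto simp: Lip_def)
  \<comment> \<open>With a common constant for \<open>f\<close> and \<open>g\<close>, it suffices
    that the maximum or minimum of two reals changes by no more than the larger of their
    changes.\<close>
  have *: "\<bar>f x - f y\<bar> \<le> max L K * dist x y" "\<bar>g x - g y\<bar> \<le> max L K * dist x y" for x y
    using lipschitz_onD[OF lipschitz_on_le[OF L, of "max L K"], of x y]
      lipschitz_onD[OF lipschitz_on_le[OF K, of "max L K"], of x y]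
    by (auto simp: dist_real_def)
  have nonneg: "0 \<le> max L K" using lipschitz_on_nonneg[OF L] by simp
  have "(max L K)-lipschitz_on UNIV (\<lambda>t. max (f t) (g t))"
  proof (rule lipschitz_onI[OF _ nonneg])
    fix x y show "dist (max (f x) (g x)) (max (f y) (g y)) \<le> max L K * dist x y"
      using *[of x y] unfolding dist_real_def by linarith
  qed
  moreover have "(max L K)-lipschitz_on UNIV (\<lambda>t. min (f t) (g t))"
  proof (rule lipschitz_onI[OF _ nonneg])
    fix x y show "dist (min (f x) (g x)) (min (f y) (g y)) \<le> max L K * dist x y"
      using *[of x y] unfolding dist_real_def by linarith
  qed
  ultimately show "(\<lambda>t. max (f t) (g t)) \<in> carr (Lip A)" "(\<lambda>t. min (f t) (g t)) \<in> carr (Lip A)"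
    using assms by (auto simp: Lip_def)
qed

lemma inj_on_hat: "inj_on (hat A) (dist_dominated A)"
proof (intro inj_onI ext)
  fix f g x assume fg: "f \<in> dist_dominated A" "g \<in> dist_dominated A" and eq: "hat A f = hat A g"
  obtain L where L: "L \<in> M1_plus A" "\<And>f. f \<in> dist_dominated A \<Longrightarrow> rel_integral L f = f x"
    using M1_plus_dirac[of x] by blast
  show "f x = g x"
    using arg_cong[OF eq, of "\<lambda>T. T (diff_of A L)"] fg L by (simp add: hat_apply M1_diff_of)
qed

text \<open>Formulated for a set \<open>S\<close> of Lipschitz functions closed under pointwise
  maximum and minimum, so that \<open>Lip A\<close> and \<open>Lip_c A\<close> are both
  instances.\<close>

lemma riesz_embedding_hat:
  fixes S :: "('a \<Rightarrow> real) set"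
  assumes S: "S \<subseteq> carr (Lip A)"
    and max: "\<And>f g. f \<in> S \<Longrightarrow> g \<in> S \<Longrightarrow> (\<lambda>t. max (f t) (g t)) \<in> S"
    and min: "\<And>f g. f \<in> S \<Longrightarrow> g \<in> S \<Longrightarrow> (\<lambda>t. min (f t) (g t)) \<in> S"
  shows "riesz_embedding ((Lip A)\<lparr>carr := S\<rparr>) (order_continuous_dual (M1 A)) (hat A)"
  unfolding riesz_embedding_def
proof (intro conjI ballI allI)
  let ?V = "(Lip A)\<lparr>carr := S\<rparr>" and ?W = "order_continuous_dual (M1 A)"
  have dom: "f \<in> dist_dominated A" if "f \<in> S" for f
    using that S Lip_dist_dominated by auto
  show "hat A ` carr ?V \<subseteq> carr ?W"
    using dom hat_in_dual by auto
  show "inj_on (hat A) (carr ?V)"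
    using dom by (auto intro: inj_on_subset[OF inj_on_hat])
  show "hat A (vscale ?V c f) = vscale ?W c (hat A f)" if "f \<in> carr ?V" for c f
    using that dom
    by (auto simp: fun_eq_iff Lip_def order_continuous_dual_def hat_def restrict_def diff_integral_cmult)
  fix f g assume "f \<in> carr ?V" "g \<in> carr ?V"
  then have fg: "f \<in> S" "g \<in> S" by auto
  show "hat A (vplus ?V f g) = vplus ?W (hat A f) (hat A g)"
    using fg dom
    by (auto simp: fun_eq_iff Lip_def order_continuous_dual_def hat_def restrict_def diff_integral_add)
  note mm = hat_max_min[OF dom[OF fg(1)] dom[OF fg(2)] dom[OF max[OF fg]] dom[OF min[OF fg]]]
  \<comment> \<open>The pointwise maximum belongs to \<open>S\<close>, so it is also the supremum
    within the smaller carrier.\<close>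
  have "is_sup ?V {f, g} (\<lambda>t. max (f t) (g t))"
    using max[OF fg] by (auto simp: is_sup_def Lip_def le_fun_def)
  then show "\<exists>h. is_sup ?V {f, g} h \<and> is_sup ?W {hat A f, hat A g} (hat A h)"
    using mm(1) by blast
  have "is_inf ?V {f, g} (\<lambda>t. min (f t) (g t))"
    using min[OF fg] by (auto simp: is_inf_def Lip_def le_fun_def)
  then show "\<exists>h. is_inf ?V {f, g} h \<and> is_inf ?W {hat A f, hat A g} (hat A h)"
    using mm(2) by blast
qed

end

theorem corollary1p5:
  fixes A :: "'a::metric_space set"
  assumes "closed A" and "A \<noteq> {}"
    and "locally_compact_space (top_of_set (- A))"
    and "\<exists>K :: nat \<Rightarrow> 'a set. (\<forall>n. compact (K n)) \<and> - A = (\<Union>n. K n)"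
  shows "riesz_embedding (Lip A) (order_continuous_dual (M1 A)) (hat A) \<and>
         riesz_embedding (Lip_c A) (order_continuous_dual (M1 A)) (hat A)"
proof -
  interpret metric_pair A using assms by unfold_locales
  \<comment> \<open>\<open>Lip A\<close> is written as an update by its own carrier to match the
    form of \<open>riesz_embedding_hat\<close>.\<close>
  have "riesz_embedding ((Lip A)\<lparr>carr := carr (Lip A)\<rparr>) (order_continuous_dual (M1 A)) (hat A)"
    by (intro riesz_embedding_hat Lip_max_min order_refl)
  moreover have "riesz_embedding (Lip_c A) (order_continuous_dual (M1 A)) (hat A)"
    unfolding Lip_c_def
  proof (rule riesz_embedding_hat)
    fix f g
    assume "f \<in> {f \<in> carr (Lip A). compact (closure {x. f x \<noteq> 0})}"
      and "g \<in> {f \<in> carr (Lip A). compact (closure {x. f x \<noteq> 0})}"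
    then have "f \<in> carr (Lip A)" "g \<in> carr (Lip A)"
      and "compact (closure {x. f x \<noteq> 0})" "compact (closure {x. g x \<noteq> 0})" by auto
    \<comment> \<open>Where \<open>f\<close> and \<open>g\<close> both vanish, so do their maximum
      and minimum, which is the remaining premise on supports.\<close>
    note fg = Lip_max_min[OF this(1,2)] compact_support_combine[OF this(3,4)]
    show "(\<lambda>t. max (f t) (g t)) \<in> {f \<in> carr (Lip A). compact (closure {x. f x \<noteq> 0})}"
      by (intro CollectI conjI fg) simp
    show "(\<lambda>t. min (f t) (g t)) \<in> {f \<in> carr (Lip A). compact (closure {x. f x \<noteq> 0})}"
      by (intro CollectI conjI fg) simp
  qed auto
  ultimately show ?thesis by simp
qed

end
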